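(* The time-improved algorithm (described in the context), run on input $N$, computes the values $\Vert n\Vert$ for all $1\le n\le N$ in time $O(N^{1.230175})$ and space $O(N\log\log N)$.
   Context: For a positive integer $n$, the complexity $\Vert n\Vert$ is the least number of $1$'s needed to express $n$ using only $+$, $\times$ and parentheses. Thus $\Vert 1\Vert=1$ and for $n\ge2$, $\Vert n\Vert$ is the minimum of $\Vert a\Vert+\Vert b\Vert$ over positive integers $a,b<n$ with $a+b=n$ or $ab=n$. Time is the number of elementary operations (arithmetic operations and comparisons on integers, reads and writes of array entries); space is measured in bits. The function $E$: $E(0)=1$, $E(1)=1$, and for $j\ge1$: $E(3j)=3^j$, $E(3j+1)=4\cdot3^{j-1}$, $E(3j-1)=2\cdot3^{j-1}$. It is computed by: if $n=0$ return $1$; otherwise start with result $=1$ and, while $n>4$, multiply result by $3$ and replace $n$ by $n-3$; return result times $n$. Time-improved algorithm, with input $N$. An array $\mathrm{Compl}[1..N]$ is initialized with all entries equal to $\lfloor 3\log N/\log 2\rfloor+1$, except $\mathrm{Compl}[1]=1$. Then for $n=2,3,\dots,N$ in increasing order: (1) replace $\mathrm{Compl}[n]$ by $\min(\mathrm{Compl}[n],\mathrm{Compl}[n-1]+1)$; (2) compute $\mathrm{kMax}$: put $T=\mathrm{Compl}[n-1]$, $t=\lfloor T/2\rfloor$; while $E(t)+E(T-t)<n$, replace $t$ by $t-1$; when the loop stops put $\mathrm{kMax}=E(t)$; (3) for each integer $m$ with $6\le m\le \mathrm{kMax}$, replace $\mathrm{Compl}[n]$ by $\min(\mathrm{Compl}[n],\mathrm{Compl}[m]+\mathrm{Compl}[n-m])$;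 (4) for each integer $k$ with $2\le k\le\min(n,\lfloor N/n\rfloor)$, replace $\mathrm{Compl}[kn]$ by $\min(\mathrm{Compl}[kn],\mathrm{Compl}[k]+\mathrm{Compl}[n])$. The output is the array $\mathrm{Compl}$; that the algorithm computes the complexities means that at the end $\mathrm{Compl}[n]=\Vert n\Vert$ for all $1\le n\le N$. *)

theory Defs
  imports Complex_Main "HOL-Library.Landau_Symbols" "HOL-Library.Log_Nat" "HOL-Library.Discrete_Functions"
begin

section \<open>Integer complexity\<close>

datatype expr = One | Sum expr expr | Product expr expr

primrec expr_val :: "expr \<Rightarrow> nat" where
  "expr_val One = 1"
| "expr_val (Sum a b) = expr_val a + expr_val b"
| "expr_val (Product a b) = expr_val a * expr_val b"

primrec ones :: "expr \<Rightarrow> nat" where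
  "ones One = 1"
| "ones (Sum a b) = ones a + ones b"
| "ones (Product a b) = ones a + ones b"

definition complexity :: "nat \<Rightarrow> nat"  (\<open>\<parallel>_\<parallel>\<close>) where
  "\<parallel>n\<parallel> = (LEAST k. \<exists>e. expr_val e = n \<and> ones e = k)"


section \<open>A register machine with one array\<close>

text \<open>
  Every instruction performs at most one elementary operation, so that all intermediate results
  live in registers. The time of a run is the number of executed instructions and tests, and its
  space is the largest number of bits occupied by the registers and the array at any moment.
\<close>

datatype reg =
    R_N | R_n | R_T | R_t | R_kMax | R_m | R_k  \<comment> \<open>the variables named in the algorithm\<close>
  | R_i | R_L | R_p | R_x | R_e | R_f | R_w | R_a | R_b | R_c | R_q  \<comment> \<open>auxiliary variables\<close>

datatype operand = V reg | C int

datatype rhs =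
    Copy operand
  | Add operand operand  (infixl \<open>[+]\<close> 65)
  | Sub operand operand  (infixl \<open>[-]\<close> 65)
  | Mul operand operand  (infixl \<open>[*]\<close> 70)
  | Div operand operand  (infixl \<open>[div]\<close> 70)
  | Read operand  (\<open>Compl[_]\<close>)

datatype test =
    Equal operand operand  (infix \<open>[=]\<close> 50)
  | Less operand operand  (infix \<open>[<]\<close> 50)
  | Leq operand operand  (infix \<open>[\<le>]\<close> 50)

datatype com =
    SKIP
  | Assign reg rhs  (infix \<open>::=\<close> 61)
  | Write operand operand  (\<open>Compl[_] ::= _\<close> [0, 62] 61)
  | Seq com com  (infixr \<open>;;\<close> 60)
  | If test com com  (\<open>(IF _/ THEN _/ ELSE _)\<close> [0, 0, 61] 61)
  | While test com  (\<open>(WHILE _/ DO _)\<close> [0, 61] 61)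

text \<open>
  The domain of \<open>array\<close> is the index range of the array; an access outside of it gets stuck.
\<close>

record state =
  val :: "reg \<Rightarrow> int"
  array :: "int \<rightharpoonup> int"

primrec opval :: "state \<Rightarrow> operand \<Rightarrow> int" where
  "opval s (V r) = val s r"
| "opval s (C c) = c"

primrec rhsval :: "state \<Rightarrow> rhs \<Rightarrow> int option" where
  "rhsval s (Copy a) = Some (opval s a)"
| "rhsval s (a [+] b) = Some (opval s a + opval s b)"
| "rhsval s (a [-] b) = Some (opval s a - opval s b)"
| "rhsval s (a [*] b) = Some (opval s a * opval s b)"
| "rhsval s (a [div] b) = Some (opval s a div opval s b)"
| "rhsval s (Compl[a]) = array s (opval s a)"

primrec testval :: "state \<Rightarrow> test \<Rightarrow> bool" where
  "testval s (a [=] b) \<longleftrightarrow> opval s a = opval s b"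
| "testval s (a [<] b) \<longleftrightarrow> opval s a < opval s b"
| "testval s (a [\<le>] b) \<longleftrightarrow> opval s a \<le> opval s b"

definition bits :: "int \<Rightarrow> nat" where
  "bits x = nat (bitlen \<bar>x\<bar>) + 1"  \<comment> \<open>binary digits and a sign bit\<close>

text \<open>All cells of the array have the same width, that of the widest current entry.\<close>

definition state_bits :: "state \<Rightarrow> nat" where
  "state_bits s =
     (\<Sum>r\<in>UNIV. bits (val s r)) + card (dom (array s)) * Max (bits ` ran (array s))"

lemma UNIV_reg:
  "UNIV = {R_N, R_n, R_T, R_t, R_kMax, R_m, R_k, R_i, R_L, R_p, R_x, R_e, R_f, R_w, R_a, R_b, R_c, R_q}"
  (is "_ = ?R")
proof -
  have "r \<in> ?R" for r
    by (cases r) simp_all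
  then show ?thesis by blast
qed

instance reg :: finite
  by standard (simp add: UNIV_reg)

definition set_reg :: "reg \<Rightarrow> int \<Rightarrow> state \<Rightarrow> state" where
  "set_reg r v s = s\<lparr>val := (val s)(r := v)\<rparr>"

definition set_cell :: "int \<Rightarrow> int \<Rightarrow> state \<Rightarrow> state" where
  "set_cell i v s = s\<lparr>array := (array s)(i \<mapsto> v)\<rparr>"

text \<open>
  \<open>exec c s t b s'\<close>: started in \<open>s\<close>, the program \<open>c\<close> terminates in \<open>s'\<close> after time \<open>t\<close>, and at most
  \<open>b\<close> bits are in use at any moment, with equality at some moment.
\<close>

inductive exec :: "com \<Rightarrow> state \<Rightarrow> nat \<Rightarrow> nat \<Rightarrow> state \<Rightarrow> bool" where
  Skip: "exec SKIP s 0 (state_bits s) s"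
| Assign: "\<lbrakk>rhsval s e = Some v; s' = set_reg r v s\<rbrakk>
    \<Longrightarrow> exec (r ::= e) s 1 (max (state_bits s) (state_bits s')) s'"
| Write: "\<lbrakk>opval s a \<in> dom (array s); s' = set_cell (opval s a) (opval s b) s\<rbrakk>
    \<Longrightarrow> exec (Compl[a] ::= b) s 1 (max (state_bits s) (state_bits s')) s'"
| Seq: "\<lbrakk>exec c\<^sub>1 s\<^sub>1 t\<^sub>1 b\<^sub>1 s\<^sub>2; exec c\<^sub>2 s\<^sub>2 t\<^sub>2 b\<^sub>2 s\<^sub>3\<rbrakk>
    \<Longrightarrow> exec (c\<^sub>1 ;; c\<^sub>2) s\<^sub>1 (t\<^sub>1 + t\<^sub>2) (max b\<^sub>1 b\<^sub>2) s\<^sub>3"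
| IfTrue: "\<lbrakk>testval s q; exec c\<^sub>1 s t b s'\<rbrakk>
    \<Longrightarrow> exec (IF q THEN c\<^sub>1 ELSE c\<^sub>2) s (1 + t) b s'"
| IfFalse: "\<lbrakk>\<not> testval s q; exec c\<^sub>2 s t b s'\<rbrakk>
    \<Longrightarrow> exec (IF q THEN c\<^sub>1 ELSE c\<^sub>2) s (1 + t) b s'"
| WhileFalse: "\<not> testval s q
    \<Longrightarrow> exec (WHILE q DO c) s 1 (state_bits s) s"
| WhileTrue: "\<lbrakk>testval s\<^sub>1 q; exec c s\<^sub>1 t\<^sub>1 b\<^sub>1 s\<^sub>2; exec (WHILE q DO c) s\<^sub>2 t\<^sub>2 b\<^sub>2 s\<^sub>3\<rbrakk>
    \<Longrightarrow> exec (WHILE q DO c) s\<^sub>1 (1 + t\<^sub>1 + t\<^sub>2) (max b\<^sub>1 b\<^sub>2) s\<^sub>3"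

inductive_cases exec_SkipE: "exec SKIP s t b s'"
inductive_cases exec_AssignE: "exec (r ::= e) s t b s'"
inductive_cases exec_WriteE: "exec (Compl[a] ::= c) s t b s'"
inductive_cases exec_SeqE: "exec (c\<^sub>1 ;; c\<^sub>2) s t b s'"
inductive_cases exec_IfE: "exec (IF q THEN c\<^sub>1 ELSE c\<^sub>2) s t b s'"
inductive_cases exec_WhileE: "exec (WHILE q DO c) s t b s'"

lemma exec_deterministic:
  assumes "exec c s t b s'" and "exec c s t' b' s''"
  shows "t = t' \<and> b = b' \<and> s' = s''"
  using assms
proof (induction arbitrary: t' b' s'' rule: exec.induct)
  case (Skip s)
  from Skip.prems show ?case by (rule exec_SkipE) simp
next
  case (Assign s e v s' r)
  from Assign.prems show ?case by (rule exec_AssignE) (use Assign.hyps in simp)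
next
  case (Write s a s' b)
  from Write.prems show ?case by (rule exec_WriteE) (use Write.hyps in simp)
next
  case (Seq c1 s1 t1 b1 s2 c2 t2 b2 s3)
  from Seq.prems obtain u1 d1 r2 u2 d2
    where *: "exec c1 s1 u1 d1 r2" "exec c2 r2 u2 d2 s''" "t' = u1 + u2" "b' = max d1 d2"
    by (rule exec_SeqE)
  have "t1 = u1 \<and> b1 = d1 \<and> s2 = r2"
    by (rule Seq.IH(1)[OF *(1)])
  moreover from this have "t2 = u2 \<and> b2 = d2 \<and> s3 = s''"
    using Seq.IH(2) *(2) by simp
  ultimately show ?case using * by simp
next
  case (IfTrue s q c1 t b s' c2)
  from IfTrue.prems IfTrue.hyps obtain u where *: "exec c1 s u b' s''" "t' = 1 + u"
    by (auto elim!: exec_IfE)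
  from IfTrue.IH[OF *(1)] show ?case using * by simp
next
  case (IfFalse s q c2 t b s' c1)
  from IfFalse.prems IfFalse.hyps obtain u where *: "exec c2 s u b' s''" "t' = 1 + u"
    by (auto elim!: exec_IfE)
  from IfFalse.IH[OF *(1)] show ?case using * by simp
next
  case (WhileFalse s q c)
  from WhileFalse.prems show ?case
    by (rule exec_WhileE) (simp_all add: WhileFalse.hyps)
next
  case (WhileTrue s1 q c t1 b1 s2 t2 b2 s3)
  from WhileTrue.prems obtain u1 d1 r2 u2 d2
    where *: "exec c s1 u1 d1 r2" "exec (WHILE q DO c) r2 u2 d2 s''"
      "t' = 1 + u1 + u2" "b' = max d1 d2"
    by (rule exec_WhileE) (use WhileTrue.hyps(1) in simp_all)
  have "t1 = u1 \<and> b1 = d1 \<and> s2 = r2"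
    by (rule WhileTrue.IH(1)[OF *(1)])
  moreover from this have "t2 = u2 \<and> b2 = d2 \<and> s3 = s''"
    using WhileTrue.IH(2) *(2) by simp
  ultimately show ?case using * by simp
qed


section \<open>The algorithm\<close>

definition E :: "nat \<Rightarrow> nat" where
  "E n = (if n \<le> 1 then 1
          else if n mod 3 = 0 then 3 ^ (n div 3)
          else if n mod 3 = 1 then 4 * 3 ^ (n div 3 - 1)
          else 2 * 3 ^ (n div 3))"

text \<open>Puts the value of \<^const>\<open>E\<close> at \<open>R_x\<close> into \<open>r\<close>.\<close>

definition compute_E :: "reg \<Rightarrow> com" where
  "compute_E r =
     IF V R_x [=] C 0 THEN r ::= Copy (C 1)
     ELSE (
       r ::= Copy (C 1);;
       WHILE C 4 [<] V R_x DO (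
         r ::= V r [*] C 3;;
         R_x ::= V R_x [-] C 3);;
       r ::= V r [*] V R_x)"

lemma E_rec: "E (n + 3) = 3 * E n" if "n \<ge> 2"
proof -
  have "(n + 3) div 3 = n div 3 + 1" "(n + 3) mod 3 = n mod 3" by simp_all
  moreover have "n div 3 \<ge> 1" if "n mod 3 = 1"
    using that \<open>n \<ge> 2\<close> by presburger
  ultimately show ?thesis
    using that by (cases "n div 3") (auto simp: E_def)
qed

lemma compute_E_loop:
  assumes "r \<noteq> R_x" "1 \<le> n" "val s R_x = int n"
  shows "\<exists>t b x s'. exec (WHILE C 4 [<] V R_x DO (r ::= V r [*] C 3;; R_x ::= V R_x [-] C 3)) s t b s' \<and>
           val s' r * val s' R_x = val s r * int (E n) \<and>
           s' = s\<lparr>val := (val s)(r := val s' r, R_x := x)\<rparr>"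
  using assms(2,3)
proof (induction n arbitrary: s rule: less_induct)
  case (less n)
  show ?case
  proof (cases "n \<le> 4")
    case True
    then have "n = 1 \<or> n = 2 \<or> n = 3 \<or> n = 4" using less.prems by linarith
    then have "E n = n" by (auto simp: E_def)
    moreover have "exec (WHILE C 4 [<] V R_x DO (r ::= V r [*] C 3;; R_x ::= V R_x [-] C 3)) s 1 (state_bits s) s"
      using True less.prems by (intro WhileFalse) simp
    moreover have "s = s\<lparr>val := (val s)(r := val s r, R_x := int n)\<rparr>"
      using less.prems by (intro state.equality) (auto simp: fun_eq_iff)
    ultimately show ?thesis using less.prems by metis
  next
    case False
    define s1 where "s1 = set_reg r (val s r * 3) s"
    define s2 where "s2 = set_reg R_x (int (n - 3)) s1"
    have n: "n - 3 < n" "1 \<le> n - 3" "val s2 R_x = int (n - 3)"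
      using False by (auto simp: s2_def set_reg_def)
    from less.IH[OF n] obtain t b x s' where IH:
      "exec (WHILE C 4 [<] V R_x DO (r ::= V r [*] C 3;; R_x ::= V R_x [-] C 3)) s2 t b s'"
      "val s' r * val s' R_x = val s2 r * int (E (n - 3))"
      "s' = s2\<lparr>val := (val s2)(r := val s' r, R_x := x)\<rparr>" by blast
    have "E n = 3 * E (n - 3)" using E_rec[of "n - 3"] False by simp
    then have "val s' r * val s' R_x = val s r * int (E n)"
      using IH(2) assms(1) by (simp add: s2_def s1_def set_reg_def)
    moreover have "s' = s\<lparr>val := (val s)(r := val s' r, R_x := x)\<rparr>"
      using assms(1) by (subst IH(3)) (auto simp: s2_def s1_def set_reg_def fun_eq_iff)
    moreover have "exec (r ::= V r [*] C 3) s 1 (max (state_bits s) (state_bits s1)) s1"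
      by (rule Assign) (auto simp: s1_def)
    moreover have "exec (R_x ::= V R_x [-] C 3) s1 1 (max (state_bits s1) (state_bits s2)) s2"
      using False assms(1) less.prems
      by (intro Assign[where v = "int (n - 3)"]) (auto simp: s1_def s2_def set_reg_def)
    moreover have "testval s (C 4 [<] V R_x)" using False less.prems by simp
    ultimately show ?thesis using IH(1) WhileTrue Seq by metis
  qed
qed

lemma compute_E_correct:
  assumes "r \<noteq> R_x" "val s R_x = int n"
  shows "\<exists>t b x. exec (compute_E r) s t b (s\<lparr>val := (val s)(R_x := x, r := int (E n))\<rparr>)"
proof (cases "n = 0")
  case True
  define s1 where "s1 = set_reg r 1 s"
  have "exec (r ::= Copy (C 1)) s 1 (max (state_bits s) (state_bits s1)) s1"
    by (rule Assign) (auto simp: s1_def)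
  then have "exec (compute_E r) s (1 + 1) (max (state_bits s) (state_bits s1)) s1"
    unfolding compute_E_def using True assms by (intro IfTrue) simp_all
  moreover have "s1 = s\<lparr>val := (val s)(R_x := val s R_x, r := int (E n))\<rparr>"
    using True by (simp add: s1_def set_reg_def E_def)
  ultimately show ?thesis by metis
next
  case False
  define s1 where "s1 = set_reg r 1 s"
  have "val s1 R_x = int n" using assms by (simp add: s1_def set_reg_def)
  with compute_E_loop[of r n s1] False assms(1) obtain t b x s2 where s2:
    "exec (WHILE C 4 [<] V R_x DO (r ::= V r [*] C 3;; R_x ::= V R_x [-] C 3)) s1 t b s2"
    "val s2 r * val s2 R_x = val s1 r * int (E n)"
    "s2 = s1\<lparr>val := (val s1)(r := val s2 r, R_x := x)\<rparr>" by auto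
  define s3 where "s3 = set_reg r (val s2 r * val s2 R_x) s2"
  have "exec (r ::= Copy (C 1)) s 1 (max (state_bits s) (state_bits s1)) s1"
    by (rule Assign) (auto simp: s1_def)
  moreover have "exec (r ::= V r [*] V R_x) s2 1 (max (state_bits s2) (state_bits s3)) s3"
    by (rule Assign) (auto simp: s3_def)
  moreover have "\<not> testval s (V R_x [=] C 0)" using False assms by simp
  ultimately have "\<exists>t b. exec (compute_E r) s t b s3"
    unfolding compute_E_def using s2(1) by (blast intro: IfFalse Seq)
  moreover have "s3 = s\<lparr>val := (val s)(R_x := x, r := int (E n))\<rparr>"
    unfolding s3_def s2(2)
    by (subst s2(3)) (use assms in \<open>auto simp: s1_def set_reg_def fun_eq_iff\<close>)
  ultimately show ?thesis by auto
qed

text \<open>\<open>\<lfloor>3 log N / log 2\<rfloor>\<close> is the number of times that \<open>N\<^sup>3\<close> can be halved before reaching \<open>1\<close>.\<close>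

definition initialize :: com where
  "initialize =
     R_p ::= V R_N [*] V R_N;;
     R_p ::= V R_p [*] V R_N;;
     R_L ::= Copy (C 0);;
     WHILE C 1 [<] V R_p DO (
       R_p ::= V R_p [div] C 2;;
       R_L ::= V R_L [+] C 1);;
     R_L ::= V R_L [+] C 1;;
     R_i ::= Copy (C 1);;
     WHILE V R_i [\<le>] V R_N DO (
       Compl[V R_i] ::= V R_L;;
       R_i ::= V R_i [+] C 1);;
     Compl[C 1] ::= C 1"

lemma halving_loop:
  assumes "1 \<le> p" "val s R_p = int p"
  shows "\<exists>t b. exec (WHILE C 1 [<] V R_p DO (R_p ::= V R_p [div] C 2;; R_L ::= V R_L [+] C 1)) s t b
           (s\<lparr>val := (val s)(R_p := 1, R_L := val s R_L + int (floor_log p))\<rparr>)"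
  using assms
proof (induction p arbitrary: s rule: less_induct)
  case (less p)
  show ?case
  proof (cases "p = 1")
    case True
    then have "s\<lparr>val := (val s)(R_p := 1, R_L := val s R_L + int (floor_log p))\<rparr> = s"
      using True less.prems by (intro state.equality) (auto simp: fun_eq_iff)
    moreover have "\<not> testval s (C 1 [<] V R_p)" using True less.prems by simp
    ultimately show ?thesis using WhileFalse by metis
  next
    case False
    define s1 where "s1 = set_reg R_p (int (p div 2)) s"
    define s2 where "s2 = set_reg R_L (val s R_L + 1) s1"
    have p: "p div 2 < p" "1 \<le> p div 2" "val s2 R_p = int (p div 2)"
      using False less.prems by (auto simp: s1_def s2_def set_reg_def)
    have "exec (R_p ::= V R_p [div] C 2) s 1 (max (state_bits s) (state_bits s1)) s1"
      using less.prems by (intro Assign[where v = "int (p div 2)"]) (simp_all add: s1_def)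
    moreover have "exec (R_L ::= V R_L [+] C 1) s1 1 (max (state_bits s1) (state_bits s2)) s2"
      by (rule Assign) (auto simp: s1_def s2_def set_reg_def)
    moreover have "testval s (C 1 [<] V R_p)" using False less.prems by simp
    moreover obtain t b where "exec (WHILE C 1 [<] V R_p DO (R_p ::= V R_p [div] C 2;; R_L ::= V R_L [+] C 1)) s2 t b
        (s2\<lparr>val := (val s2)(R_p := 1, R_L := val s2 R_L + int (floor_log (p div 2)))\<rparr>)"
      using less.IH[OF p] by (elim exE)
    ultimately have "\<exists>t b. exec (WHILE C 1 [<] V R_p DO (R_p ::= V R_p [div] C 2;; R_L ::= V R_L [+] C 1)) s t b
        (s2\<lparr>val := (val s2)(R_p := 1, R_L := val s2 R_L + int (floor_log (p div 2)))\<rparr>)"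
      by (intro exI) (rule WhileTrue[OF _ Seq])
    moreover have "int (floor_log p) = 1 + int (floor_log (p div 2))"
      using floor_log_rec[of p] False less.prems by (simp del: floor_log_half)
    then have "s2\<lparr>val := (val s2)(R_p := 1, R_L := val s2 R_L + int (floor_log (p div 2)))\<rparr>
        = s\<lparr>val := (val s)(R_p := 1, R_L := val s R_L + int (floor_log p))\<rparr>"
      by (auto simp: s1_def s2_def set_reg_def fun_eq_iff simp del: floor_log_half)
    ultimately show ?thesis by metis
  qed
qed

lemma fill_loop:
  assumes "dom (array s) = {1..val s R_N}" "1 \<le> val s R_i" "val s R_i + int d = val s R_N + 1"
  shows "\<exists>t b. exec (WHILE V R_i [\<le>] V R_N DO (Compl[V R_i] ::= V R_L;; R_i ::= V R_i [+] C 1)) s t b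
           \<lparr>val = (val s)(R_i := val s R_N + 1),
            array = (\<lambda>j. if val s R_i \<le> j \<and> j \<le> val s R_N then Some (val s R_L) else array s j)\<rparr>"
  using assms
proof (induction d arbitrary: s)
  case 0
  have "\<lparr>val = (val s)(R_i := val s R_N + 1),
         array = (\<lambda>j. if val s R_i \<le> j \<and> j \<le> val s R_N then Some (val s R_L) else array s j)\<rparr> = s"
    using 0(3) by (intro state.equality) (auto simp: fun_eq_iff)
  moreover have "\<not> testval s (V R_i [\<le>] V R_N)" using 0(3) by simp
  ultimately show ?case using WhileFalse by metis
next
  case (Suc d)
  define s1 where "s1 = set_cell (val s R_i) (val s R_L) s"
  define s2 where "s2 = set_reg R_i (val s R_i + 1) s1"
  have prems: "dom (array s2) = {1..val s2 R_N}" "1 \<le> val s2 R_i" "val s2 R_i + int d = val s2 R_N + 1"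
    using Suc.prems by (auto simp: s1_def s2_def set_reg_def set_cell_def)
  have "exec (Compl[V R_i] ::= V R_L) s 1 (max (state_bits s) (state_bits s1)) s1"
    by (rule Write) (use Suc.prems in \<open>auto simp: s1_def\<close>)
  moreover have "exec (R_i ::= V R_i [+] C 1) s1 1 (max (state_bits s1) (state_bits s2)) s2"
    by (rule Assign) (auto simp: s1_def s2_def set_reg_def set_cell_def)
  moreover have "testval s (V R_i [\<le>] V R_N)" using Suc.prems(3) by simp
  moreover have "\<lparr>val = (val s2)(R_i := val s2 R_N + 1),
         array = (\<lambda>j. if val s2 R_i \<le> j \<and> j \<le> val s2 R_N then Some (val s2 R_L) else array s2 j)\<rparr>
       = \<lparr>val = (val s)(R_i := val s R_N + 1),
         array = (\<lambda>j. if val s R_i \<le> j \<and> j \<le> val s R_N then Some (val s R_L) else array s j)\<rparr>"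
    using Suc.prems(3) by (auto simp: s1_def s2_def set_reg_def set_cell_def fun_eq_iff)
  moreover obtain t b where "exec (WHILE V R_i [\<le>] V R_N DO (Compl[V R_i] ::= V R_L;; R_i ::= V R_i [+] C 1)) s2 t b
       \<lparr>val = (val s2)(R_i := val s2 R_N + 1),
         array = (\<lambda>j. if val s2 R_i \<le> j \<and> j \<le> val s2 R_N then Some (val s2 R_L) else array s2 j)\<rparr>"
    using Suc.IH[OF prems] by (elim exE)
  ultimately have "exec (Compl[V R_i] ::= V R_L;; R_i ::= V R_i [+] C 1) s (1 + 1)
      (max (max (state_bits s) (state_bits s1)) (max (state_bits s1) (state_bits s2))) s2"
    and *: "testval s (V R_i [\<le>] V R_N)"
    and "exec (WHILE V R_i [\<le>] V R_N DO (Compl[V R_i] ::= V R_L;; R_i ::= V R_i [+] C 1)) s2 t b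
      \<lparr>val = (val s)(R_i := val s R_N + 1),
       array = (\<lambda>j. if val s R_i \<le> j \<and> j \<le> val s R_N then Some (val s R_L) else array s j)\<rparr>"
    by (simp_all only: Seq)
  from WhileTrue[OF *(1) this(1,3)] show ?case by (intro exI)
qed

lemma initialize_correct:
  assumes "1 \<le> N" "val s R_N = int N" "dom (array s) = {1..int N}"
  shows "\<exists>t b s'. exec initialize s t b s' \<and> val s' R_N = int N \<and>
    array s' = (\<lambda>i. if i = 1 then Some 1
                    else if 2 \<le> i \<and> i \<le> int N then Some (\<lfloor>3 * ln (real N) / ln 2\<rfloor> + 1) else None)"
proof -
  have "log 2 (real (N * N * N)) = 3 * ln (real N) / ln 2"
    using assms(1) by (simp add: log_def ln_mult add_divide_distrib)
  moreover have "0 \<le> 3 * ln (real N) / ln 2"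
    using assms(1) by simp
  ultimately have L: "int (floor_log (N * N * N)) = \<lfloor>3 * ln (real N) / ln 2\<rfloor>"
    using assms(1) by (simp add: floor_log_altdef)
  define s1 where "s1 = set_reg R_p (int (N * N)) s"
  define s2 where "s2 = set_reg R_p (int (N * N * N)) s1"
  define s3 where "s3 = set_reg R_L 0 s2"
  define s4 where "s4 = s3\<lparr>val := (val s3)(R_p := 1, R_L := val s3 R_L + int (floor_log (N * N * N)))\<rparr>"
  define s5 where "s5 = set_reg R_L (val s4 R_L + 1) s4"
  define s6 where "s6 = set_reg R_i 1 s5"
  define s7 where "s7 = \<lparr>val = (val s6)(R_i := val s6 R_N + 1),
    array = (\<lambda>j. if val s6 R_i \<le> j \<and> j \<le> val s6 R_N then Some (val s6 R_L) else array s6 j)\<rparr>"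
  define s8 where "s8 = set_cell 1 1 s7"
  note defs = s1_def s2_def s3_def s4_def s5_def s6_def s7_def set_reg_def
  have e1: "exec (R_p ::= V R_N [*] V R_N) s 1 (max (state_bits s) (state_bits s1)) s1"
    by (rule Assign) (use assms in \<open>auto simp: s1_def\<close>)
  have e2: "exec (R_p ::= V R_p [*] V R_N) s1 1 (max (state_bits s1) (state_bits s2)) s2"
    by (rule Assign) (use assms in \<open>auto simp: s1_def s2_def set_reg_def\<close>)
  have e3: "exec (R_L ::= Copy (C 0)) s2 1 (max (state_bits s2) (state_bits s3)) s3"
    by (rule Assign) (auto simp: s3_def)
  have e4: "\<exists>t b. exec (WHILE C 1 [<] V R_p DO (R_p ::= V R_p [div] C 2;; R_L ::= V R_L [+] C 1)) s3 t b s4"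
    unfolding s4_def by (rule halving_loop) (use assms(1) in \<open>auto simp: s1_def s2_def s3_def set_reg_def\<close>)
  have e5: "exec (R_L ::= V R_L [+] C 1) s4 1 (max (state_bits s4) (state_bits s5)) s5"
    by (rule Assign) (auto simp: s5_def)
  have e6: "exec (R_i ::= Copy (C 1)) s5 1 (max (state_bits s5) (state_bits s6)) s6"
    by (rule Assign) (auto simp: s6_def)
  have s6: "array s6 = array s" "val s6 R_N = int N" "val s6 R_i = 1"
    using assms(2) by (simp_all add: defs)
  have e7: "\<exists>t b. exec (WHILE V R_i [\<le>] V R_N DO (Compl[V R_i] ::= V R_L;; R_i ::= V R_i [+] C 1)) s6 t b s7"
    unfolding s7_def by (rule fill_loop[where d = N]) (simp_all add: s6 assms(3))
  have N7: "val s7 R_N = int N"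
    using assms(2) by (simp add: defs)
  have a7: "array s7 = (\<lambda>i. if 1 \<le> i \<and> i \<le> int N
      then Some (\<lfloor>3 * ln (real N) / ln 2\<rfloor> + 1) else None)"
  proof
    fix i
    have "array s i = None" if "\<not> (1 \<le> i \<and> i \<le> int N)"
    proof -
      have "i \<notin> dom (array s)" unfolding assms(3) using that by simp
      then show ?thesis by (simp add: domIff)
    qed
    then show "array s7 i = (if 1 \<le> i \<and> i \<le> int N
        then Some (\<lfloor>3 * ln (real N) / ln 2\<rfloor> + 1) else None)"
      by (simp add: defs assms(2) flip: L)
  qed
  have e8: "exec (Compl[C 1] ::= C 1) s7 1 (max (state_bits s7) (state_bits s8)) s8"
    by (rule Write) (use assms(1) a7 in \<open>auto simp: s8_def\<close>)
  have "\<exists>t b. exec initialize s t b s8"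
  proof -
    obtain t4 b4 t7 b7 where
      "exec (WHILE C 1 [<] V R_p DO (R_p ::= V R_p [div] C 2;; R_L ::= V R_L [+] C 1)) s3 t4 b4 s4"
      "exec (WHILE V R_i [\<le>] V R_N DO (Compl[V R_i] ::= V R_L;; R_i ::= V R_i [+] C 1)) s6 t7 b7 s7"
      using e4 e7 by (elim exE)
    from Seq[OF e1 Seq[OF e2 Seq[OF e3 Seq[OF this(1) Seq[OF e5 Seq[OF e6 Seq[OF this(2) e8]]]]]]]
    show ?thesis unfolding initialize_def by (intro exI)
  qed
  moreover have "val s8 R_N = int N"
    using N7 by (simp add: s8_def set_cell_def)
  moreover have "array s8 = (\<lambda>i. if i = 1 then Some 1
      else if 2 \<le> i \<and> i \<le> int N then Some (\<lfloor>3 * ln (real N) / ln 2\<rfloor> + 1) else None)"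
    by (auto simp: s8_def set_cell_def a7 fun_eq_iff)
  ultimately show ?thesis by blast
qed

text \<open>Replaces entry \<open>i\<close> of the array by its minimum with \<open>R_c\<close>.\<close>

definition minimize :: "reg \<Rightarrow> com" where
  "minimize i =
     R_w ::= Compl[V i];;
     IF V R_c [<] V R_w THEN R_w ::= Copy (V R_c) ELSE SKIP;;
     Compl[V i] ::= V R_w"

definition step1 :: com where
  "step1 =
     R_i ::= V R_n [-] C 1;;
     R_a ::= Compl[V R_i];;
     R_c ::= V R_a [+] C 1;;
     minimize R_n"

definition evaluate_guard :: com where
  "evaluate_guard =
     R_x ::= Copy (V R_t);;
     compute_E R_e;;
     R_x ::= V R_T [-] V R_t;;
     compute_E R_f;;
     R_w ::= V R_e [+] V R_f"

definition step2 :: com where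
  "step2 =
     R_i ::= V R_n [-] C 1;;
     R_T ::= Compl[V R_i];;
     R_t ::= V R_T [div] C 2;;
     evaluate_guard;;
     WHILE V R_w [<] V R_n DO (
       R_t ::= V R_t [-] C 1;;
       evaluate_guard);;
     R_x ::= Copy (V R_t);;
     compute_E R_kMax"

definition step3 :: com where
  "step3 =
     R_m ::= Copy (C 6);;
     WHILE V R_m [\<le>] V R_kMax DO (
       R_i ::= V R_n [-] V R_m;;
       R_a ::= Compl[V R_m];;
       R_b ::= Compl[V R_i];;
       R_c ::= V R_a [+] V R_b;;
       minimize R_n;;
       R_m ::= V R_m [+] C 1)"

definition step4 :: com where
  "step4 =
     R_q ::= V R_N [div] V R_n;;
     IF V R_n [<] V R_q THEN R_q ::= Copy (V R_n) ELSE SKIP;;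
     R_k ::= Copy (C 2);;
     WHILE V R_k [\<le>] V R_q DO (
       R_p ::= V R_k [*] V R_n;;
       R_a ::= Compl[V R_k];;
       R_b ::= Compl[V R_n];;
       R_c ::= V R_a [+] V R_b;;
       minimize R_p;;
       R_k ::= V R_k [+] C 1)"

definition time_improved :: com where
  "time_improved =
     initialize;;
     R_n ::= Copy (C 2);;
     WHILE V R_n [\<le>] V R_N DO (
       step1;;
       step2;;
       step3;;
       step4;;
       R_n ::= V R_n [+] C 1)"

definition input_state :: "nat \<Rightarrow> state" where
  "input_state N =
     \<lparr>val = (\<lambda>_. 0)(R_N := int N),
      array = (\<lambda>i. if 1 \<le> i \<and> i \<le> int N then Some 0 else None)\<rparr>"

end

theory Submission
  imports Defs "HOL-Real_Asymp.Real_Asymp"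
begin

text \<open>
  Correctness: if \<open>\<parallel>n\<parallel> = \<parallel>a\<parallel> + \<parallel>b\<parallel>\<close> with \<open>a + b = n\<close> beats \<open>\<parallel>n - 1\<parallel> + 1\<close>, then \<open>\<parallel>a\<parallel> + \<parallel>b\<parallel> \<le> T = \<parallel>n - 1\<parallel>\<close>,
  and as \<open>k \<le> E \<parallel>k\<parallel>\<close>, the smaller summand is at most \<open>E u\<close> for some \<open>u \<le> T / 2\<close> with
  \<open>E u + E (T - u) \<ge> n\<close>.

  Time: the dominating cost at \<open>n\<close> is \<open>kMax = E t\<close>. From \<open>E t + E (T - t) \<ge> n\<close> and
  \<open>E t * E (T - t) \<le> E T \<le> 3 powr (T / 3)\<close> it is at most \<open>2 * 3 powr (\<parallel>n - 1\<parallel> / 3) / n\<close>, so that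
  everything rests on \<open>(\<Sum>n\<le>N. 3 powr (\<parallel>n\<parallel> / 3) / n) = O(N powr 1.23)\<close>. Split this sum into the residue
  classes modulo \<open>24\<close>. Each class is reduced to others by one of \<open>n \<mapsto> n - 1\<close>, \<open>n / 2\<close>, \<open>n / 3\<close>, at the
  expense of the factors \<open>3 powr (1/3)\<close>, \<open>3 powr (2/3) / 2\<close> and \<open>1\<close>, and the last two moves
  shrink \<open>N\<close>. It thus suffices to find a potential on the residues that decreases along a
  suitable choice of moves, and \<open>24\<close> residues are enough for the exponent \<open>1.23\<close>.
\<close>

section \<open>Integer complexity\<close>

lemma expr_val_pos: "expr_val e \<ge> 1"
  by (induction e) simp_all

lemma ones_pos: "ones e \<ge> 1"
  by (induction e) simp_all

lemma complexity_le: "\<parallel>expr_val e\<parallel> \<le> ones e"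
  unfolding complexity_def by (rule Least_le) blast

lemma ex_expr_val: "n \<ge> 1 \<Longrightarrow> \<exists>e. expr_val e = n"
proof (induction n rule: nat_induct_at_least)
  case base
  show ?case by (rule exI[of _ One]) simp
next
  case (Suc n)
  then obtain e where "expr_val e = n" by blast
  then have "expr_val (Sum e One) = Suc n" by simp
  then show ?case ..
qed

lemma ex_expr_complexity:
  assumes "n \<ge> 1"
  obtains e where "expr_val e = n" "ones e = \<parallel>n\<parallel>"
proof -
  have "\<exists>k e. expr_val e = n \<and> ones e = k" using ex_expr_val[OF assms] by blast
  then have "\<exists>e. expr_val e = n \<and> ones e = \<parallel>n\<parallel>" unfolding complexity_def by (rule LeastI_ex)
  then show thesis using that by blast
qed

lemma complexity_ge_1: "n \<ge> 1 \<Longrightarrow> \<parallel>n\<parallel> \<ge> 1"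
  by (metis ex_expr_complexity ones_pos)

lemma complexity_add_le: "a \<ge> 1 \<Longrightarrow> b \<ge> 1 \<Longrightarrow> \<parallel>a + b\<parallel> \<le> \<parallel>a\<parallel> + \<parallel>b\<parallel>"
  by (metis complexity_le ex_expr_complexity expr_val.simps(2) ones.simps(2))

lemma complexity_mult_le: "a \<ge> 1 \<Longrightarrow> b \<ge> 1 \<Longrightarrow> \<parallel>a * b\<parallel> \<le> \<parallel>a\<parallel> + \<parallel>b\<parallel>"
  by (metis complexity_le ex_expr_complexity expr_val.simps(3) ones.simps(3))

lemma complexity_1 [simp]: "\<parallel>1\<parallel> = 1" "\<parallel>Suc 0\<parallel> = 1"
proof -
  show "\<parallel>1\<parallel> = 1"
    using complexity_le[of One] complexity_ge_1[of 1] by simp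
  then show "\<parallel>Suc 0\<parallel> = 1" by simp
qed

lemma complexity_Suc_le: "n \<ge> 1 \<Longrightarrow> \<parallel>Suc n\<parallel> \<le> \<parallel>n\<parallel> + 1"
  using complexity_add_le[of n 1] by simp

text \<open>The outermost operation of an optimal expression splits it into two expressions that are
  again optimal, since cheaper ones could be substituted. A factor 1 is impossible, because the
  other factor alone would be a cheaper expression for \<open>n\<close>.\<close>

lemma complexity_cases:
  assumes "n \<ge> 2"
  obtains (add) a b where "1 \<le> a" "1 \<le> b" "a + b = n" "\<parallel>n\<parallel> = \<parallel>a\<parallel> + \<parallel>b\<parallel>"
  | (mult) a b where "2 \<le> a" "2 \<le> b" "a * b = n" "\<parallel>n\<parallel> = \<parallel>a\<parallel> + \<parallel>b\<parallel>"
proof -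
  obtain e where e: "expr_val e = n" "ones e = \<parallel>n\<parallel>"
    using ex_expr_complexity assms by (metis one_le_numeral order_trans)
  show thesis
  proof (cases e)
    case One
    then show thesis using e assms by simp
  next
    case (Sum c d)
    have "\<parallel>n\<parallel> = \<parallel>expr_val c\<parallel> + \<parallel>expr_val d\<parallel>"
      using Sum e complexity_le[of c] complexity_le[of d] expr_val_pos[of c] expr_val_pos[of d]
        complexity_add_le[of "expr_val c" "expr_val d"] by simp
    then show thesis using Sum e add[of "expr_val c" "expr_val d"] expr_val_pos[of c] expr_val_pos[of d] by simp
  next
    case (Product c d)
    have ne: "expr_val c \<noteq> 1" "expr_val d \<noteq> 1"
      using Product e complexity_le[of c] complexity_le[of d] ones_pos[of c] ones_pos[of d] by auto
    have "\<parallel>n\<parallel> = \<parallel>expr_val c\<parallel> + \<parallel>expr_val d\<parallel>"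
      using Product e complexity_le[of c] complexity_le[of d] expr_val_pos[of c] expr_val_pos[of d]
        complexity_mult_le[of "expr_val c" "expr_val d"] by simp
    moreover have "2 \<le> expr_val c" "2 \<le> expr_val d"
      using ne expr_val_pos[of c] expr_val_pos[of d] by linarith+
    ultimately show thesis using mult Product e by simp
  qed
qed

lemma complexity_double_le: "m \<ge> 1 \<Longrightarrow> \<parallel>2 * m\<parallel> \<le> \<parallel>m\<parallel> + 2"
  using complexity_mult_le[of 2 m] complexity_Suc_le[of 1] by (simp add: numeral_2_eq_2)

lemma complexity_triple_le: "m \<ge> 1 \<Longrightarrow> \<parallel>3 * m\<parallel> \<le> \<parallel>m\<parallel> + 3"
  using complexity_mult_le[of 3 m] complexity_Suc_le[of 1] complexity_Suc_le[of 2]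
  by (simp add: numeral_2_eq_2 numeral_3_eq_3)

text \<open>In a binary Horner scheme each halving costs at most three ones and shrinks
  \<open>n ^ 3\<close> by a factor of at least 8. The recursion stops at 2 and 3, since the bound
  fails at 1. Taking logarithms, the initial entries of the array turn out to be large
  enough.\<close>

lemma two_power_complexity_le: "n \<ge> 2 \<Longrightarrow> 2 ^ \<parallel>n\<parallel> \<le> n ^ 3"
proof (induction n rule: less_induct)
  case (less n)
  have c2: "\<parallel>2\<parallel> \<le> 2" using complexity_double_le[of 1] complexity_Suc_le[of 1] by (simp add: numeral_2_eq_2)
  have c3: "\<parallel>3\<parallel> \<le> 3" using c2 complexity_Suc_le[of 2] by (simp add: numeral_2_eq_2 numeral_3_eq_3)
  consider "n = 2" | "n = 3" | "n \<ge> 4" using less.prems by linarith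
  then show ?case
  proof cases
    case 1
    have "(2::nat) ^ \<parallel>2\<parallel> \<le> 2 ^ 2" using c2 by (intro power_increasing) auto
    then show ?thesis using 1 by simp
  next
    case 2
    have "(2::nat) ^ \<parallel>3\<parallel> \<le> 2 ^ 3" using c3 by (intro power_increasing) auto
    then show ?thesis using 2 by simp
  next
    case 3
    define m where "m = n div 2"
    have m: "m \<ge> 2" "m < n" using 3 by (auto simp: m_def)
    have IH: "2 ^ \<parallel>m\<parallel> \<le> m ^ 3" using less.IH m by blast
    show ?thesis
    proof (cases "even n")
      case True
      then have n: "n = 2 * m" by (simp add: m_def)
      have "(2::nat) ^ \<parallel>n\<parallel> \<le> 2 ^ (\<parallel>m\<parallel> + 2)"
        using complexity_double_le[of m] m by (intro power_increasing) (auto simp: n)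
      also have "\<dots> \<le> 8 * m ^ 3" using IH by (simp add: power_add)
      also have "\<dots> = n ^ 3" by (simp add: n power_mult_distrib)
      finally show ?thesis .
    next
      case False
      then have n: "n = Suc (2 * m)" unfolding m_def by presburger
      have "(2::nat) ^ \<parallel>n\<parallel> \<le> 2 ^ (\<parallel>m\<parallel> + 3)"
        using complexity_double_le[of m] complexity_Suc_le[of "2 * m"] m
        by (intro power_increasing) (auto simp: n)
      also have "\<dots> \<le> 8 * m ^ 3" using IH by (simp add: power_add)
      also have "\<dots> = (2 * m) ^ 3" by (simp add: power_mult_distrib)
      also have "\<dots> \<le> n ^ 3" using n by (intro power_mono) auto
      finally show ?thesis .
    qed
  qed
qed

section \<open>The function \<^const>\<open>E\<close>\<close>

lemma E_simps [simp]: "E 0 = 1" "E (Suc 0) = 1" "E 2 = 2" "E 3 = 3" "E 4 = 4"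
  by (simp_all add: E_def)

text \<open>Induction along \<open>E_rec\<close>, which needs \<open>n \<ge> 2\<close>; hence the
  five base values 0 to 4.\<close>

lemma E_induct [case_names small step]:
  fixes n :: nat
  assumes "\<And>n. n \<le> 4 \<Longrightarrow> P n" and "\<And>n. n \<ge> 2 \<Longrightarrow> P n \<Longrightarrow> P (n + 3)"
  shows "P n"
proof (induction n rule: less_induct)
  case (less n)
  show ?case
  proof (cases "n \<le> 4")
    case False
    then have "P (n - 3 + 3)" by (intro assms(2) less.IH) auto
    then show ?thesis using False by simp
  qed (rule assms(1))
qed

lemma le_4_cases: "n \<le> 4 \<Longrightarrow> n = 0 \<or> n = Suc 0 \<or> n = 2 \<or> n = 3 \<or> n = 4" for n :: nat
  by linarith

lemma E_pos: "E n \<ge> 1"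
  by (simp add: E_def)

lemma E_5_to_8: "E 5 = 6" "E 6 = 9" "E 7 = 12" "E 8 = 18"
  using E_rec[of 2] E_rec[of 3] E_rec[of 4] E_rec[of 5] by simp_all

text \<open>Lowering an argument by 3 divides both sides by 3, until only arguments up to 4
  remain.\<close>

lemma E_mult_le: "E a * E b \<le> E (a + b)"
proof (induction a rule: E_induct)
  case (small a)
  show ?case
  proof (induction b rule: E_induct)
    case (small b)
    from le_4_cases[OF this] le_4_cases[OF \<open>a \<le> 4\<close>] show ?case
      by (elim disjE) (simp_all add: E_5_to_8 flip: numeral_2_eq_2)
  next
    case (step b)
    then show ?case using E_rec[of b] E_rec[of "a + b"] by (simp add: add.assoc)
  qed
next
  case (step a)
  have "E (a + 3 + b) = 3 * E (a + b)" using E_rec[of "a + b"] step(1) by (simp add: ac_simps)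
  then show ?case using step E_rec[of a] by simp
qed

lemma E_mono: "a \<le> b \<Longrightarrow> E a \<le> E b"
  using E_mult_le[of a "b - a"] E_pos[of "b - a"] by (simp add: dual_order.trans)

lemma E_less_Suc: "n \<ge> 1 \<Longrightarrow> E n + 1 \<le> E (n + 1)"
proof (induction n rule: E_induct)
  case (small n)
  from le_4_cases[OF this(1)] small(2) show ?case
    by (elim disjE) (simp_all add: E_5_to_8 flip: numeral_2_eq_2 add_Suc)
next
  case (step n)
  then show ?case using E_rec[of n] E_rec[of "n + 1"] by simp
qed

text \<open>If both arguments are at least 2, so are both values, and then the sum is at most the
  product. An argument 1 has value 1 and is left to \<open>E_less_Suc\<close>.\<close>

lemma E_add_le:
  assumes "a \<ge> 1" "b \<ge> 1"
  shows "E a + E b \<le> E (a + b)"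
proof -
  consider "a = 1" | "b = 1" | "a \<ge> 2" "b \<ge> 2" using assms by linarith
  then show ?thesis
  proof cases
    case 3
    have "E a \<ge> 2" "E b \<ge> 2" using E_mono[OF 3(1)] E_mono[OF 3(2)] by simp_all
    then have "E a + E b \<le> E a * E b"
      using mult_le_mono1[of 2 "E a" "E b"] mult_le_mono2[of 2 "E b" "E a"] by linarith
    then show ?thesis using E_mult_le order_trans by blast
  qed (use E_less_Suc[OF assms(1)] E_less_Suc[OF assms(2)] in auto)
qed

text \<open>Integer form of \<open>E n \<le> 3 powr (n / 3)\<close>. Adding 3 to \<open>n\<close>
  multiplies both sides by 27, and equality holds at the multiples of 3.\<close>

lemma E_cube_le: "E n ^ 3 \<le> 3 ^ n"
proof (induction n rule: E_induct)
  case (small n)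
  from le_4_cases[OF this] show ?case by (elim disjE) simp_all
next
  case (step n)
  then show ?case using E_rec[of n] by (simp add: power_mult_distrib power_add)
qed

text \<open>No expression with \<open>k\<close> ones exceeds \<open>E k\<close>, because
  \<open>E\<close> absorbs both operations by \<open>E_add_le\<close> and
  \<open>E_mult_le\<close>.\<close>

lemma expr_val_le_E: "expr_val e \<le> E (ones e)"
proof (induction e)
  case (Sum a b)
  then show ?case using E_add_le[of "ones a" "ones b"] ones_pos[of a] ones_pos[of b] by simp
next
  case (Product a b)
  then have "expr_val a * expr_val b \<le> E (ones a) * E (ones b)" by (rule mult_le_mono)
  then show ?case using E_mult_le[of "ones a" "ones b"] by simp
qed simp

lemma le_E_complexity: "n \<ge> 1 \<Longrightarrow> n \<le> E \<parallel>n\<parallel>"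
  by (metis ex_expr_complexity expr_val_le_E)

text \<open>For \<open>n\<close> from 2 to 5 even \<open>E (n - 1)\<close> stays below
  \<open>n\<close>, whereas \<open>E 5 = 6\<close>. This is why \<open>step3\<close> may start at
  \<open>m = 6\<close>: a smaller summand is no cheaper than adding ones one at a time.\<close>

lemma complexity_ge_self:
  assumes "1 \<le> n" "n \<le> 5"
  shows "\<parallel>n\<parallel> \<ge> n"
proof (rule ccontr)
  assume "\<not> \<parallel>n\<parallel> \<ge> n"
  then have "E \<parallel>n\<parallel> \<le> E (n - 1)" "n \<noteq> 1" using complexity_ge_1[of 1] by (auto intro: E_mono)
  moreover have "n = 2 \<or> n = 3 \<or> n = 4 \<or> n = 5" using assms \<open>n \<noteq> 1\<close> by linarith
  then have "E (n - 1) < n" by (elim disjE) simp_all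
  ultimately show False using le_E_complexity[OF assms(1)] by simp
qed

lemma complexity_add_le_self: "m \<ge> 1 \<Longrightarrow> \<parallel>m + k\<parallel> \<le> \<parallel>m\<parallel> + k"
proof (induction k)
  case (Suc k)
  then show ?case using complexity_Suc_le[of "m + k"] by simp
qed simp

text \<open>Since \<open>3 \<le> 4\<close>, this follows by squaring
  \<open>two_power_complexity_le\<close>. It yields two crude bounds: \<open>E_complexity_le\<close>
  for the size of the registers, \<open>E_half_complexity_le\<close> for the size of
  \<open>kMax\<close>.\<close>

lemma three_power_complexity_le: "n \<ge> 2 \<Longrightarrow> 3 ^ \<parallel>n\<parallel> \<le> n ^ 6"
proof -
  assume "n \<ge> 2"
  have "(3::nat) ^ \<parallel>n\<parallel> \<le> 4 ^ \<parallel>n\<parallel>" by (rule power_mono) auto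
  also have "\<dots> = (2 ^ \<parallel>n\<parallel>) ^ 2" by (simp add: power_mult power2_eq_square flip: power_mult_distrib)
  also have "\<dots> \<le> (n ^ 3) ^ 2" using two_power_complexity_le[OF \<open>n \<ge> 2\<close>] by (rule power_mono) simp
  finally show ?thesis by (simp flip: power_mult)
qed

lemma E_complexity_le: "n \<ge> 1 \<Longrightarrow> E \<parallel>n\<parallel> \<le> n ^ 2"
proof (cases "n = 1")
  case False
  assume "n \<ge> 1"
  then have "E \<parallel>n\<parallel> ^ 3 \<le> (n ^ 2) ^ 3"
    using False three_power_complexity_le[of n] E_cube_le[of "\<parallel>n\<parallel>"]
    by (simp add: order_trans flip: power_mult)
  then show ?thesis using power_le_imp_le_base[of "E \<parallel>n\<parallel>" 2 "n ^ 2"] by (simp add: eval_nat_numeral)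
qed simp

text \<open>Makes \<open>kMax\<close>, an \<open>E t\<close> with \<open>t\<close> at most half of
  \<open>\<parallel>n - 1\<parallel>\<close>, smaller than \<open>n\<close>, so that
  \<open>step3\<close> reads only finished entries.\<close>

lemma E_half_complexity_le: "n \<ge> 1 \<Longrightarrow> E (\<parallel>n\<parallel> div 2) \<le> n"
proof (cases "n = 1")
  case False
  assume "n \<ge> 1"
  have "E (\<parallel>n\<parallel> div 2) ^ 6 = (E (\<parallel>n\<parallel> div 2) ^ 3) ^ 2" by (simp flip: power_mult)
  also have "\<dots> \<le> (3 ^ (\<parallel>n\<parallel> div 2)) ^ 2" using E_cube_le by (rule power_mono) simp
  also have "\<dots> \<le> 3 ^ \<parallel>n\<parallel>" by (simp flip: power_mult)
  also have "\<dots> \<le> n ^ 6" using False \<open>n \<ge> 1\<close> by (intro three_power_complexity_le) simp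
  finally show ?thesis by (simp add: power_mono_iff)
qed simp

section \<open>Growth of the complexity on average\<close>

text \<open>This is \<open>3 powr (\<parallel>n\<parallel> / 3) / n\<close>; the power of a cube
  root keeps the exponent a natural number.\<close>

definition growth :: "nat \<Rightarrow> real" where
  "growth n = root 3 3 ^ \<parallel>n\<parallel> / real n"

text \<open>The cubes of the two fractions lie just above 3 and 9. The first one is the coefficient
  39/27 of the move to the predecessor.\<close>

lemma cube_root_3: "root 3 3 ^ 3 = (3::real)" "root 3 3 \<ge> (1::real)" "root 3 3 \<le> (13/9 :: real)"
  "root 3 3 ^ 2 \<le> (2081 / 1000 :: real)"
proof -
  show "root 3 3 ^ 3 = (3::real)" by simp
  show "root 3 3 \<ge> (1::real)" by simp
  have "root 3 3 \<le> root 3 ((13/9 :: real) ^ 3)" by (intro real_root_le_mono) (simp_all add: field_simps)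
  then show "root 3 3 \<le> (13/9 :: real)" by (simp add: real_root_power_cancel)
  have "root 3 3 ^ 2 = root 3 (9 :: real)" by (simp flip: real_root_power)
  also have "\<dots> \<le> root 3 ((2081 / 1000 :: real) ^ 3)" by (intro real_root_le_mono) (simp_all add: field_simps)
  finally show "root 3 3 ^ 2 \<le> (2081 / 1000 :: real)" by (simp add: real_root_power_cancel)
qed

lemma growth_nonneg: "growth n \<ge> 0"
  by (simp add: growth_def)

text \<open>Multiplication by \<open>p\<close> adds at most \<open>k\<close> ones to the exponent
  and exactly the factor \<open>p\<close> to the denominator. It is applied with
  \<open>p = k = 2\<close> and with \<open>p = k = 3\<close>.\<close>

lemma growth_mult_le:
  assumes "p \<ge> 1" "m \<ge> 1" "\<parallel>p * m\<parallel> \<le> k + \<parallel>m\<parallel>"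
  shows "growth (p * m) \<le> root 3 3 ^ k / real p * growth m"
proof -
  have "root 3 3 ^ \<parallel>p * m\<parallel> \<le> root 3 3 ^ (k + \<parallel>m\<parallel>)" (is "_ \<le> (_::real)")
    using assms(3) cube_root_3 by (intro power_increasing)
  then show ?thesis using assms by (simp add: growth_def power_add divide_simps)
qed

lemma growth_Suc_le:
  assumes "n \<ge> 1"
  shows "growth (Suc n) \<le> root 3 3 * growth n"
proof -
  have "root 3 3 ^ \<parallel>Suc n\<parallel> \<le> root 3 3 ^ (Suc \<parallel>n\<parallel>)" (is "_ \<le> (_::real)")
    using complexity_Suc_le[OF assms] cube_root_3 by (intro power_increasing) auto
  then show ?thesis
    unfolding growth_def using assms frac_le[of "root 3 3 ^ (Suc \<parallel>n\<parallel>)" "root 3 3 ^ \<parallel>Suc n\<parallel>" "real n" "real (Suc n)"]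
    by simp
qed

section \<open>Sums of the growth over residue classes\<close>

definition class_sum :: "nat \<Rightarrow> nat \<Rightarrow> nat \<Rightarrow> real" where
  "class_sum M r N = sum growth {n \<in> {1..N}. n mod M = r}"

lemma class_sum_nonneg: "class_sum M r N \<ge> 0"
  unfolding class_sum_def by (intro sum_nonneg growth_nonneg)

text \<open>Decrementing maps the class of \<open>r\<close> into that of \<open>r - 1\<close>, where
  \<open>r \<ge> 1\<close> excludes a wrap-around. Only 1 has no positive predecessor; it
  contributes the separate term \<open>growth 1 = root 3 3\<close>.\<close>

lemma class_sum_pred:
  assumes "1 \<le> r" "r < M"
  shows "class_sum M r N \<le> (if r = 1 then root 3 3 else 0) + root 3 3 * class_sum M (r - 1) (N - 1)"
proof -
  let ?A = "{n \<in> {1..N}. n mod M = r}" and ?B = "{n \<in> {1..N - 1}. n mod M = r - 1}"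
  have "n \<in> Suc ` ?B" if "n \<in> ?A - {1}" for n
  proof -
    have "n \<ge> 2" "n mod M = r" "n \<le> N" using that by auto
    then have "(n - 1) mod M = r - 1" using assms mod_Suc[of "n - 1" M] by (auto split: if_splits)
    then show ?thesis using \<open>n \<ge> 2\<close> \<open>n \<le> N\<close> by (intro image_eqI[of _ _ "n - 1"]) auto
  qed
  then have "sum growth (?A - {1}) \<le> sum growth (Suc ` ?B)"
    by (intro sum_mono2) (auto simp: growth_nonneg)
  also have "\<dots> = (\<Sum>n\<in>?B. growth (Suc n))" by (simp add: sum.reindex)
  also have "\<dots> \<le> (\<Sum>n\<in>?B. root 3 3 * growth n)" by (intro sum_mono growth_Suc_le) auto
  finally have "sum growth (?A - {1}) \<le> root 3 3 * class_sum M (r - 1) (N - 1)"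
    by (simp add: class_sum_def sum_distrib_left)
  moreover have "sum growth ?A \<le> (if r = 1 then root 3 3 else 0) + sum growth (?A - {1})"
  proof (cases "1 \<in> ?A")
    case True
    then have "r = 1" using assms by auto
    have "growth 1 = root 3 3" by (simp add: growth_def)
    then show ?thesis using \<open>r = 1\<close> sum.remove[OF _ True, of growth] by simp
  next
    case False
    then have "?A - {1} = ?A" by blast
    then show ?thesis by auto
  qed
  ultimately show ?thesis by (simp add: class_sum_def)
qed

text \<open>The numbers congruent to \<open>p * r\<close> modulo \<open>p * d\<close> are the
  \<open>p * m\<close> with \<open>m\<close> congruent to \<open>r\<close> modulo \<open>d\<close>.
  Seen modulo \<open>p * d\<close> again, these \<open>m\<close> spread over the \<open>p\<close>
  classes \<open>r + j * d\<close>, so that the system of residues stays closed.\<close>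

lemma class_sum_mult:
  assumes "p \<ge> 1" "d \<ge> 1" "r < d" and cost: "\<And>m. m \<ge> 1 \<Longrightarrow> \<parallel>p * m\<parallel> \<le> k + \<parallel>m\<parallel>"
  shows "class_sum (p * d) (p * r) N \<le> root 3 3 ^ k / real p * (\<Sum>j<p. class_sum (p * d) (r + j * d) (N div p))"
proof -
  let ?A = "{n \<in> {1..N}. n mod (p * d) = p * r}" and ?B = "{m \<in> {1..N div p}. m mod d = r}"
  have A: "?A = (*) p ` ?B"
  proof (intro set_eqI iffI)
    fix n assume n: "n \<in> ?A"
    then have "p dvd n" by (metis (mono_tags, lifting) dvd_mod_iff dvd_triv_left mem_Collect_eq)
    then obtain m where m: "n = p * m" ..
    have "m mod d = r" using n assms(1) unfolding m by auto
    then have "m \<in> ?B" using n m assms(1)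
      by (auto simp: less_eq_div_iff_mult_less_eq mult.commute)
    then show "n \<in> (*) p ` ?B" using m by blast
  next
    fix n assume "n \<in> (*) p ` ?B"
    then obtain m where m: "n = p * m" "1 \<le> m" "m \<le> N div p" "m mod d = r" by auto
    have "n mod (p * d) = p * r" unfolding m(1) mult_mod_right[symmetric] m(4) ..
    moreover have "p * m \<le> N" using m(3) assms(1) by (simp add: less_eq_div_iff_mult_less_eq mult.commute)
    ultimately show "n \<in> ?A" using m assms(1) by simp
  qed
  have "class_sum (p * d) (p * r) N = (\<Sum>m\<in>?B. growth (p * m))"
    unfolding class_sum_def A using assms(1) by (simp add: sum.reindex inj_on_def)
  also have "\<dots> \<le> (\<Sum>m\<in>?B. root 3 3 ^ k / real p * growth m)"
    using assms(1) cost by (intro sum_mono growth_mult_le) auto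
  also have "\<dots> = root 3 3 ^ k / real p * sum growth ?B" by (simp add: sum_distrib_left)
  \<comment> \<open>As \<open>m mod (p * d) = m mod d + (m div d mod p) * d\<close>, the digit
    \<open>m div d mod p\<close> selects the lifted class.\<close>
  also have "sum growth ?B = (\<Sum>j<p. sum growth {m \<in> ?B. m div d mod p = j})"
    by (rule sum.group[symmetric]) (use assms(1) in auto)
  also have "\<dots> = (\<Sum>j<p. class_sum (p * d) (r + j * d) (N div p))"
  proof (intro sum.cong refl)
    fix j assume "j \<in> {..<p}"
    have "m mod d = r \<and> m div d mod p = j \<longleftrightarrow> m mod (p * d) = r + j * d" for m
    proof
      assume "m mod d = r \<and> m div d mod p = j"
      then show "m mod (p * d) = r + j * d" using mod_mult2_eq[of m d p] by (simp add: mult.commute)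
    next
      assume *: "m mod (p * d) = r + j * d"
      have "m mod d = r + j * d - j * d" using mod_mod_cancel[of d "p * d" m] * assms(3) by simp
      moreover have "m div d mod p = j"
        using * mod_mult2_eq[of m d p] \<open>r < d\<close> calculation by (simp add: mult.commute)
      ultimately show "m mod d = r \<and> m div d mod p = j" by simp
    qed
    then have "{m \<in> ?B. m div d mod p = j} = {n \<in> {1..N div p}. n mod (p * d) = r + j * d}" by auto
    then show "sum growth {m \<in> ?B. m div d mod p = j} = class_sum (p * d) (r + j * d) (N div p)"
      by (simp add: class_sum_def)
  qed
  finally show ?thesis .
qed

text \<open>
  A rounded numerical eigenvector of the map that sends \<open>c\<close> to the vector with entries
  \<open>min (39/27 * c (r - 1)) (12/27 * (c (r/2) + c (r/2 + 12))) (7/27 * (c (r/3) + c (r/3 + 8) + c (r/3 + 16)))\<close>.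
  Its eigenvalue is just below \<open>1\<close>, and the coefficients bound \<open>3 powr (1/3)\<close>,
  \<open>3 powr (2/3) / 2 / 2 powr 1.23\<close> and \<open>1 / 3 powr 1.23\<close> from above.
\<close>

definition potential :: "nat \<Rightarrow> nat" where
  "potential r = [89, 129, 129, 123, 129, 187, 113, 164, 118, 147, 171, 248,
                  111, 161, 161, 135, 136, 197, 135, 196, 186, 170, 246, 356] ! r"

text \<open>The 24 residues are checked by computation, with the common denominator 27 cleared. The
  \<open>+ 1\<close> in \<open>pred\<close> reserves room for the separate term of
  \<open>class_sum_pred\<close>.\<close>

lemma potential_cases:
  assumes "r < 24"
  obtains (pred) "1 \<le> r" "39 * potential (r - 1) + 1 \<le> 27 * potential r"
  | (half) k where "k < 12" "r = 2 * k" "12 * (potential k + potential (k + 12)) \<le> 27 * potential r"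
  | (third) k where "k < 8" "r = 3 * k"
      "7 * (potential k + potential (k + 8) + potential (k + 16)) \<le> 27 * potential r"
proof -
  have "\<forall>r\<in>set [0..<24]. (1 \<le> r \<and> 39 * potential (r - 1) + 1 \<le> 27 * potential r) \<or>
    (even r \<and> 12 * (potential (r div 2) + potential (r div 2 + 12)) \<le> 27 * potential r) \<or>
    (3 dvd r \<and> 7 * (potential (r div 3) + potential (r div 3 + 8) + potential (r div 3 + 16)) \<le> 27 * potential r)"
    by (simp add: potential_def upt_rec[of _ 24] del: set_upt) presburger
  moreover have "r \<in> set [0..<24]" using assms by simp
  ultimately consider "1 \<le> r" "39 * potential (r - 1) + 1 \<le> 27 * potential r"
    | "even r" "12 * (potential (r div 2) + potential (r div 2 + 12)) \<le> 27 * potential r"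
    | "3 dvd r" "7 * (potential (r div 3) + potential (r div 3 + 8) + potential (r div 3 + 16)) \<le> 27 * potential r"
    by blast
  then show thesis
  proof cases
    case 1
    then show thesis by (rule pred)
  next
    case 2
    then show thesis using assms by (intro half[of "r div 2"]) auto
  next
    case 3
    then show thesis using assms by (intro third[of "r div 3"]) auto
  qed
qed

lemma div_powr_le:
  fixes a :: real
  assumes "a \<ge> 0" "p \<ge> 1"
  shows "real (N div p) powr a \<le> real N powr a / real p powr a"
proof -
  have "real (N div p) powr a \<le> (real N / real p) powr a"
    using assms of_nat_div_le_of_nat[of N p, where ?'a = real] by (intro powr_mono2) auto
  then show ?thesis using assms by (simp add: powr_divide)
qed

text \<open>Taking 100th powers leaves comparisons of rationals
  \<open>a ^ 100 \<le> b ^ 123\<close>. The first constant is large enough for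
  \<open>2081/2000 \<le> 12/27 * 2345/1000\<close>; the second is the reciprocal of the coefficient
  7/27.\<close>

lemma powr_123_ge: "(2345/1000::real) \<le> 2 powr (123/100)" "(27/7::real) \<le> 3 powr (123/100)"
proof -
  have *: "a \<le> b powr (123/100)" if "a ^ 100 \<le> b ^ 123" "a > 0" "b > 0" for a b :: real
  proof (rule ccontr)
    assume "\<not> a \<le> b powr (123/100)"
    then have "(b powr (123/100)) ^ 100 < a ^ 100" using that by (intro power_strict_mono) auto
    moreover have "(b powr (123/100)) ^ 100 = b ^ 123"
      using that powr_realpow[of "b powr (123/100)" 100] powr_realpow[of b 123] by (simp add: powr_powr)
    ultimately show False using that by simp
  qed
  show "(2345/1000::real) \<le> 2 powr (123/100)"
    by (rule *) (simp_all add: field_simps)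
  show "(27/7::real) \<le> 3 powr (123/100)"
    by (rule *) (simp_all add: field_simps)
qed

text \<open>The induction on \<open>N\<close> treats all residues at once, since every move reaches
  a smaller \<open>N\<close> in other classes. The factor 39 makes the surplus 1 in
  \<open>pred\<close> worth 39/27 = 13/9, which bounds the separate term of
  \<open>class_sum_pred\<close>.\<close>

lemma class_sum_le: "r < 24 \<Longrightarrow> class_sum 24 r N \<le> 39 * real (potential r) * real N powr (123/100)"
proof (induction N arbitrary: r rule: less_induct)
  case (less N)
  note q = cube_root_3
  show ?case
  proof (cases "N = 0")
    case True
    then show ?thesis by (simp add: class_sum_def)
  next
    case False
    let ?X = "real N powr (123/100)"
    have X: "?X \<ge> 1" using False by (simp add: ge_one_powr_ge_zero)
    have IH: "class_sum 24 r (N div p) \<le> 39 * real (potential r) * (?X / real p powr (123/100))"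
      if "r < 24" "p \<ge> 2" for r p
    proof -
      have "class_sum 24 r (N div p) \<le> 39 * real (potential r) * real (N div p) powr (123/100)"
        using less.IH[of "N div p" r] that False by simp
      also have "\<dots> \<le> 39 * real (potential r) * (?X / real p powr (123/100))"
        using div_powr_le[of "123/100" p N] that by (intro mult_left_mono) auto
      finally show ?thesis .
    qed
    from less.prems show ?thesis
    proof (cases rule: potential_cases)
      case pred
      have "class_sum 24 (r - 1) (N - 1) \<le> 39 * real (potential (r - 1)) * real (N - 1) powr (123/100)"
        using less.IH[of "N - 1" "r - 1"] less.prems False by simp
      also have "\<dots> \<le> 39 * real (potential (r - 1)) * ?X"
        by (intro mult_left_mono powr_mono2) auto
      finally have "root 3 3 * class_sum 24 (r - 1) (N - 1) \<le> 13/9 * (39 * real (potential (r - 1)) * ?X)"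
        using q by (intro mult_mono class_sum_nonneg) auto
      then have "class_sum 24 r N \<le> 13/9 + 13/9 * (39 * real (potential (r - 1)) * ?X)"
        using class_sum_pred[of r 24 N] pred(1) less.prems q(3) by (auto split: if_splits)
      \<comment> \<open>The additive constant is absorbed because \<open>?X \<ge> 1\<close>.\<close>
      also have "\<dots> \<le> 13/9 * ?X + 13/9 * (39 * real (potential (r - 1)) * ?X)" using X by simp
      also have "\<dots> = 13/9 * real (39 * potential (r - 1) + 1) * ?X" by (simp add: algebra_simps)
      also have "\<dots> \<le> 13/9 * real (27 * potential r) * ?X"
        using pred(2) by (intro mult_right_mono mult_left_mono) (linarith | simp)+
      finally show ?thesis by simp
    next
      case (half k)
      have coeff: "root 3 3 ^ 2 / 2 * (x / 2 powr (123/100)) \<le> 12 / 27 * x" if "x \<ge> 0" for x :: real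
      proof -
        have "root 3 3 ^ 2 / 2 \<le> 12 / 27 * (2 powr (123/100) :: real)"
          using cube_root_3(4) powr_123_ge(1) by linarith
        then have "root 3 3 ^ 2 / 2 * x \<le> 12 / 27 * 2 powr (123/100) * x"
          using that by (rule mult_right_mono)
        then have "root 3 3 ^ 2 / 2 * x / 2 powr (123/100) \<le> 12 / 27 * x"
          by (subst pos_divide_le_eq) (simp_all add: mult_ac)
        then show ?thesis by simp
      qed
      have "class_sum 24 r N \<le> root 3 3 ^ 2 / 2 * (class_sum 24 k (N div 2) + class_sum 24 (k + 12) (N div 2))"
        using class_sum_mult[of 2 12 k 2 N] half(1,2) complexity_double_le
        by (simp add: lessThan_Suc numeral_2_eq_2 add.commute)
      also have "\<dots> \<le> root 3 3 ^ 2 / 2 * (39 * real (potential k) * (?X / 2 powr (123/100))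
          + 39 * real (potential (k + 12)) * (?X / 2 powr (123/100)))"
        using IH[of k 2] IH[of "k + 12" 2] half(1) by (intro mult_left_mono add_mono) auto
      also have "\<dots> = root 3 3 ^ 2 / 2 * (39 * real (potential k + potential (k + 12)) * ?X / 2 powr (123/100))"
        by (simp add: algebra_simps add_divide_distrib)
      also have "\<dots> \<le> 12 / 27 * (39 * real (potential k + potential (k + 12)) * ?X)"
        by (rule coeff) simp
      also have "\<dots> = 39 / 27 * real (12 * (potential k + potential (k + 12))) * ?X" by simp
      also have "\<dots> \<le> 39 / 27 * real (27 * potential r) * ?X"
        using half(3) by (intro mult_right_mono mult_left_mono) (linarith | simp)+
      finally show ?thesis by simp
    next
      case (third k)
      let ?p = "potential k + potential (k + 8) + potential (k + 16)"
      have coeff: "x / 3 powr (123/100) \<le> 7 / 27 * x" if "x \<ge> 0" for x :: real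
      proof -
        have "x \<le> 7 / 27 * x * 3 powr (123/100)"
          using mult_right_mono[OF powr_123_ge(2) that] by (simp only: mult_ac)
        then show ?thesis by (subst pos_divide_le_eq) simp_all
      qed
      \<comment> \<open>Tripling costs three ones, so the factor \<open>root 3 3 ^ 3 / 3\<close> is
        exactly 1.\<close>
      have "class_sum 24 r N \<le> class_sum 24 k (N div 3) + class_sum 24 (k + 8) (N div 3) + class_sum 24 (k + 16) (N div 3)"
      proof -
        have "(\<Sum>j<3. f j) = f 0 + f 1 + f 2" for f :: "nat \<Rightarrow> real"
          by (simp add: numeral_3_eq_3 numeral_2_eq_2)
        then show ?thesis
          using class_sum_mult[of 3 8 k 3 N] third(1,2) complexity_triple_le cube_root_3(1)
          by (simp add: add.commute[of 3])
      qed
      also have "\<dots> \<le> 39 * real (potential k) * (?X / 3 powr (123/100))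
          + 39 * real (potential (k + 8)) * (?X / 3 powr (123/100))
          + 39 * real (potential (k + 16)) * (?X / 3 powr (123/100))"
        using IH[of k 3] IH[of "k + 8" 3] IH[of "k + 16" 3] third(1) by (intro add_mono) auto
      also have "\<dots> = 39 * real ?p * ?X / 3 powr (123/100)"
        by (simp add: algebra_simps add_divide_distrib)
      also have "\<dots> \<le> 7 / 27 * (39 * real ?p * ?X)"
        by (rule coeff) simp
      also have "\<dots> = 39 / 27 * real (7 * ?p) * ?X" by simp
      also have "\<dots> \<le> 39 / 27 * real (27 * potential r) * ?X"
        using third(3) by (intro mult_right_mono mult_left_mono) (linarith | simp)+
      finally show ?thesis by simp
    qed
  qed
qed

lemma sum_growth_le: "\<exists>C>0. \<forall>N. (\<Sum>n = 1..N. growth n) \<le> C * real N powr (123/100)"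
proof (intro exI conjI allI)
  let ?P = "\<Sum>r<24. 39 * real (potential r)"
  show "0 < ?P + 1" by (intro add_nonneg_pos sum_nonneg) auto
  fix N
  have "(\<Sum>n = 1..N. growth n) = (\<Sum>r<24. class_sum 24 r N)"
    unfolding class_sum_def by (rule sum.group[symmetric]) auto
  also have "\<dots> \<le> (\<Sum>r<24. 39 * real (potential r) * real N powr (123/100))"
    by (intro sum_mono class_sum_le) simp
  also have "\<dots> \<le> (?P + 1) * real N powr (123/100)"
    by (simp add: sum_distrib_right algebra_simps)
  finally show "(\<Sum>n = 1..N. growth n) \<le> (?P + 1) * real N powr (123/100)" .
qed

text \<open>The hypothesis on \<open>t\<close> is what the search in \<open>step2\<close> has
  established when it stops at \<open>t\<close>. The three outcomes match the candidates of
  \<open>step1\<close>, \<open>step3\<close> and \<open>step4\<close>, so that one of these is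
  always optimal.\<close>

lemma complexity_attained:
  assumes "n \<ge> 2" and T: "T = \<parallel>n - 1\<parallel>" and
    t: "\<And>u. t < u \<Longrightarrow> u \<le> T div 2 \<Longrightarrow> E u + E (T - u) < n"
  obtains (Suc) "\<parallel>n\<parallel> = \<parallel>n - 1\<parallel> + 1"
  | (add) m where "6 \<le> m" "m \<le> E t" "\<parallel>n\<parallel> = \<parallel>m\<parallel> + \<parallel>n - m\<parallel>"
  | (mult) a b where "2 \<le> a" "a \<le> b" "b < n" "a * b = n" "\<parallel>n\<parallel> = \<parallel>a\<parallel> + \<parallel>b\<parallel>"
proof -
  note add_case = add
  from assms(1) show thesis
  proof (cases rule: complexity_cases)
    case (add a b)
    have wlog: thesis if "1 \<le> a" "a \<le> b" "a + b = n" "\<parallel>n\<parallel> = \<parallel>a\<parallel> + \<parallel>b\<parallel>" for a b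
    proof (cases "\<parallel>n\<parallel> = T + 1")
      case True
      then show thesis using Suc T by simp
    next
      case False
      have "\<parallel>n\<parallel> \<le> T + 1" using complexity_Suc_le[of "n - 1"] assms(1) T by simp
      with False have le: "\<parallel>a\<parallel> + \<parallel>b\<parallel> \<le> T" using that(4) by simp
      have "a > 5"
      proof (rule ccontr)
        assume "\<not> a > 5"
        then have "\<parallel>a\<parallel> \<ge> a" using complexity_ge_self that(1) by simp
        moreover have "T \<le> \<parallel>b\<parallel> + (a - 1)"
          using complexity_add_le_self[of b "a - 1"] that T by (simp add: add.commute)
        ultimately show False using le that(1) by simp
      qed
      \<comment> \<open>The smaller summand need not have the smaller complexity. Either way
        \<open>a \<le> E c\<close>, because \<open>a \<le> b\<close> and both are bounded by
        \<open>E\<close> of their complexities.\<close>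
      define c where "c = min \<parallel>a\<parallel> \<parallel>b\<parallel>"
      have ab: "a \<le> E \<parallel>a\<parallel>" "b \<le> E \<parallel>b\<parallel>" using le_E_complexity that by simp_all
      have "n \<le> E c + E (T - c)"
      proof (cases "\<parallel>a\<parallel> \<le> \<parallel>b\<parallel>")
        case True
        have "E \<parallel>b\<parallel> \<le> E (T - \<parallel>a\<parallel>)" using le by (intro E_mono) simp
        then show ?thesis using True ab that(3) by (simp add: c_def)
      next
        case False
        have "E \<parallel>a\<parallel> \<le> E (T - \<parallel>b\<parallel>)" using le by (intro E_mono) simp
        then show ?thesis using False ab that(3) by (simp add: c_def)
      qed
      moreover have "c \<le> T div 2" using le by (auto simp: c_def min_def)
      ultimately have "c \<le> t" using t[of c] by force
      then have "E c \<le> E t" by (rule E_mono)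
      moreover have "a \<le> E c" using ab that(2) by (auto simp: c_def min_def)
      ultimately show thesis using \<open>a > 5\<close> that by (intro add_case[of a]) auto
    qed
    show thesis
    proof (cases "a \<le> b")
      case True
      then show thesis using wlog[of a b] add by simp
    next
      case False
      then show thesis using wlog[of b a] add by simp
    qed
  next
    case (mult a b)
    have "a < n" "b < n" using mult(1,2) by (auto simp flip: mult(3))
    show thesis
    proof (cases "a \<le> b")
      case True
      then show thesis using mult \<open>b < n\<close> that(3)[of a b] by simp
    next
      case False
      then show thesis using mult \<open>a < n\<close> that(3)[of b a] by (simp add: mult.commute)
    qed
  qed
qed

text \<open>Since \<open>E t \<le> E (T - t)\<close>, the second summand is at least \<open>n / 2\<close>, while the product is at most \<open>E T\<close>.\<close>

lemma E_le_growth: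
  assumes "n \<ge> 2" "T = \<parallel>n - 1\<parallel>" "t \<le> T div 2" "n \<le> E t + E (T - t)"
  shows "real (E t) \<le> 2 * growth (n - 1)"
proof -
  have "E t \<le> E (T - t)" using assms(3) by (intro E_mono) simp
  then have "n \<le> 2 * E (T - t)" using assms(4) by simp
  then have "E t * n \<le> 2 * (E t * E (T - t))" by simp
  also have "E t * E (T - t) \<le> E T" using E_mult_le[of t "T - t"] assms(3) by simp
  finally have *: "E t * n \<le> 2 * E T" by simp
  have "real (E T ^ 3) \<le> real (3 ^ T)" using E_cube_le[of T] by (simp only: of_nat_le_iff)
  also have "\<dots> = (root 3 3 ^ T) ^ 3" using cube_root_3(1) by (simp flip: power_mult add: mult.commute[of T] power_mult)
  finally have "real (E T) \<le> root 3 3 ^ T"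
    using power_le_imp_le_base[of "real (E T)" 2 "root 3 3 ^ T"] by (simp add: eval_nat_numeral)
  moreover have "real (E t) * real n \<le> 2 * real (E T)" using * by (simp flip: of_nat_mult)
  ultimately have "real (E t) * real n \<le> 2 * root 3 3 ^ T" by linarith
  moreover have "real (E t) * real (n - 1) \<le> real (E t) * real n" by (intro mult_left_mono) auto
  ultimately have "real (E t) * real (n - 1) \<le> 2 * root 3 3 ^ T" by linarith
  then show ?thesis using assms(1,2) by (simp add: growth_def pos_le_divide_eq)
qed

section \<open>Resource-bounded runs\<close>

definition tab :: "nat \<Rightarrow> (nat \<Rightarrow> nat) \<Rightarrow> int \<rightharpoonup> int" where
  "tab N g = (\<lambda>i. if 1 \<le> i \<and> i \<le> int N then Some (int (g (nat i))) else None)"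

lemma tab_int [simp]: "1 \<le> i \<Longrightarrow> i \<le> N \<Longrightarrow> tab N g (int i) = Some (int (g i))"
  by (simp add: tab_def)

lemma dom_tab: "dom (tab N g) = {1..int N}"
  by (auto simp: tab_def split: if_splits)

lemma tab_upd: "1 \<le> i \<Longrightarrow> i \<le> N \<Longrightarrow> (tab N g)(int i \<mapsto> int v) = tab N (g(i := v))"
  by (auto simp: tab_def fun_eq_iff)

lemma bits_mono: "\<bar>x\<bar> \<le> \<bar>y\<bar> \<Longrightarrow> bits x \<le> bits y"
  by (simp add: bits_def bitlen_def floorlog_mono)

locale bounded_run =
  fixes N :: nat
  assumes N_pos: "1 \<le> N"
begin

text \<open>This is the initial value of the entries. After initialization entries are only lowered,
  so it bounds them throughout.\<close>

definition cell_bound :: nat where "cell_bound = floor_log (N ^ 3) + 1"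
text \<open>Initialization computes \<open>N ^ 3\<close>. The factor 4 leaves room for sums of two
  values, for increments past \<open>N\<close> and for small constants.\<close>

definition reg_bound :: nat where "reg_bound = 4 * N ^ 3"

definition fits :: "state \<Rightarrow> bool" where
  "fits s \<longleftrightarrow> (\<forall>r. \<bar>val s r\<bar> \<le> int reg_bound) \<and>
     (\<exists>g. array s = tab N g \<and> (\<forall>i. 1 \<le> i \<and> i \<le> N \<longrightarrow> g i \<le> cell_bound))"

text \<open>There are 18 registers, and all \<open>N\<close> cells have the width needed for
  \<open>cell_bound\<close>.\<close>

definition space_bound :: nat where
  "space_bound = 18 * bits (int reg_bound) + N * bits (int cell_bound)"

text \<open>Total correctness with resources: termination and the space bound are built in, so that
  later arguments only track \<open>fits\<close>, while the running time is handed to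
  \<open>Q\<close>. As runs are deterministic, the existence of one run suffices.\<close>

definition yields :: "com \<Rightarrow> (nat \<Rightarrow> state \<Rightarrow> bool) \<Rightarrow> state \<Rightarrow> bool" where
  "yields c Q s \<longleftrightarrow> (\<exists>t b s'. exec c s t b s' \<and> b \<le> space_bound \<and> Q t s')"

lemma cell_bound_le: "cell_bound \<le> N ^ 3"
proof -
  have "2 ^ floor_log (N ^ 3) \<le> N ^ 3" using N_pos by (intro floor_log_exp2_le) simp
  moreover have "floor_log (N ^ 3) < 2 ^ floor_log (N ^ 3)" by (rule less_exp)
  ultimately have "floor_log (N ^ 3) < N ^ 3" by (rule order.strict_trans2[rotated])
  then show ?thesis by (simp add: cell_bound_def)
qed

lemma reg_bound_ge: "N \<le> N ^ 3" "N ^ 2 \<le> N ^ 3" "1 \<le> N ^ 3" "2 \<le> N \<Longrightarrow> 8 \<le> N ^ 3"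
  using N_pos power_increasing[of 1 3 N] power_increasing[of 2 3 N] power_mono[of 2 N 3] by simp_all

lemma fits_val: "fits s \<Longrightarrow> \<bar>val s r\<bar> \<le> int reg_bound"
  by (simp add: fits_def)

text \<open>\<open>fits\<close> only provides some table for the array, but any two tables of the
  same array agree on the indices 1 to \<open>N\<close>.\<close>

lemma fits_cell:
  assumes "fits s" "array s = tab N g" "1 \<le> i" "i \<le> N"
  shows "g i \<le> cell_bound"
proof -
  obtain g' where g': "tab N g = tab N g'" "g' i \<le> cell_bound"
    using assms by (auto simp: fits_def)
  have "tab N g (int i) = tab N g' (int i)" using g'(1) by simp
  then have "g i = g' i" unfolding tab_int[OF assms(3,4)] by simp
  then show ?thesis using g'(2) by simp
qed

lemma fits_state_bits:
  assumes "fits s"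
  shows "state_bits s \<le> space_bound"
proof -
  obtain g where g: "array s = tab N g" "\<And>i. 1 \<le> i \<and> i \<le> N \<Longrightarrow> g i \<le> cell_bound"
    using assms by (auto simp: fits_def)
  have "(\<Sum>r\<in>UNIV. bits (val s r)) \<le> (\<Sum>r\<in>(UNIV :: reg set). bits (int reg_bound))"
    using fits_val[OF assms] by (intro sum_mono bits_mono) simp
  also have "\<dots> = 18 * bits (int reg_bound)" by (simp add: UNIV_reg)
  finally have 1: "(\<Sum>r\<in>UNIV. bits (val s r)) \<le> 18 * bits (int reg_bound)" .
  have ran: "ran (tab N g) = (\<lambda>i. int (g i)) ` {1..N}"
  proof (intro set_eqI iffI)
    fix y assume "y \<in> ran (tab N g)"
    then obtain i where "tab N g i = Some y" by (auto simp: ran_def)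
    then have "1 \<le> i" "i \<le> int N" "y = int (g (nat i))" by (auto simp: tab_def split: if_splits)
    then show "y \<in> (\<lambda>i. int (g i)) ` {1..N}" by (intro image_eqI[of _ _ "nat i"]) auto
  next
    fix y assume "y \<in> (\<lambda>i. int (g i)) ` {1..N}"
    then obtain i where "1 \<le> i" "i \<le> N" "y = int (g i)" by auto
    then have "tab N g (int i) = Some y" by simp
    then show "y \<in> ran (tab N g)" by (rule ranI)
  qed
  have "Max (bits ` ran (tab N g)) \<le> bits (int cell_bound)"
    unfolding ran using N_pos g(2) by (subst Max_le_iff) (auto intro!: bits_mono)
  then have "card (dom (array s)) * Max (bits ` ran (array s)) \<le> N * bits (int cell_bound)"
    by (simp add: g(1) dom_tab)
  with 1 show ?thesis unfolding state_bits_def space_bound_def by (rule add_mono)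
qed

lemma fits_set_reg: "fits s \<Longrightarrow> \<bar>v\<bar> \<le> int reg_bound \<Longrightarrow> fits (set_reg r v s)"
  by (auto simp: fits_def set_reg_def)

lemma fits_set_cell:
  assumes "fits s" "array s = tab N g" "1 \<le> i" "i \<le> N" "v \<le> cell_bound"
  shows "fits (set_cell (int i) (int v) s)"
proof -
  have "array (set_cell (int i) (int v) s) = tab N (g(i := v))"
    using assms by (simp add: set_cell_def tab_upd)
  moreover have "\<forall>j. 1 \<le> j \<and> j \<le> N \<longrightarrow> (g(i := v)) j \<le> cell_bound"
    using assms fits_cell by auto
  moreover have "\<bar>val (set_cell (int i) (int v) s) r\<bar> \<le> int reg_bound" for r
    using fits_val[OF assms(1)] by (simp add: set_cell_def)
  ultimately show ?thesis unfolding fits_def by blast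
qed

section \<open>Rules for resource-bounded runs of commands\<close>

lemma yields_mono: "yields c Q s \<Longrightarrow> (\<And>t s'. Q t s' \<Longrightarrow> Q' t s') \<Longrightarrow> yields c Q' s"
  unfolding yields_def by blast

lemma yields_Skip: "fits s \<Longrightarrow> Q 0 s \<Longrightarrow> yields SKIP Q s"
  unfolding yields_def using exec.Skip fits_state_bits by blast

lemma yields_Assign:
  assumes "fits s" "\<exists>v. rhsval s e = Some v \<and> \<bar>v\<bar> \<le> int reg_bound"
    and "\<And>v s'. fits s' \<Longrightarrow> rhsval s e = Some v \<Longrightarrow> val s' = (val s)(r := v) \<Longrightarrow> array s' = array s \<Longrightarrow> Q 1 s'"
  shows "yields (r ::= e) Q s"
proof -
  obtain v where v: "rhsval s e = Some v" "\<bar>v\<bar> \<le> int reg_bound" using assms(2) by blast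
  have fits': "fits (set_reg r v s)" by (rule fits_set_reg[OF assms(1) v(2)])
  have "Q 1 (set_reg r v s)" by (rule assms(3)[OF fits' v(1)]) (simp_all add: set_reg_def)
  moreover have "max (state_bits s) (state_bits (set_reg r v s)) \<le> space_bound"
    using fits_state_bits[OF assms(1)] fits_state_bits[OF fits'] by simp
  ultimately show ?thesis unfolding yields_def using exec.Assign[OF v(1) refl] by blast
qed

lemma yields_Write:
  assumes "fits s" "array s = tab N g" "opval s a = int i" "1 \<le> i" "i \<le> N" "opval s b = int v" "v \<le> cell_bound"
    and "\<And>s'. fits s' \<Longrightarrow> val s' = val s \<Longrightarrow> array s' = tab N (g(i := v)) \<Longrightarrow> Q 1 s'"
  shows "yields (Compl[a] ::= b) Q s"
proof -
  let ?s = "set_cell (opval s a) (opval s b) s"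
  have fits': "fits ?s" using fits_set_cell assms by simp
  have "Q 1 ?s"
    by (rule assms(8)[OF fits']) (use assms in \<open>simp_all add: set_cell_def tab_upd\<close>)
  moreover have "max (state_bits s) (state_bits ?s) \<le> space_bound"
    using fits_state_bits[OF assms(1)] fits_state_bits[OF fits'] by simp
  moreover have "opval s a \<in> dom (array s)" using assms by (simp add: dom_tab)
  ultimately show ?thesis unfolding yields_def using exec.Write[OF _ refl] by blast
qed

text \<open>The remaining program becomes part of the postcondition, and the time used so far is
  added inside it. Repeated use thus executes straight-line code symbolically; the nested sums
  \<open>1 + (1 + ...)\<close> in later goals are the accumulated times.\<close>

lemma yields_Seq: "yields c (\<lambda>t s'. yields d (\<lambda>u. Q (t + u)) s') s \<Longrightarrow> yields (c ;; d) Q s"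
proof -
  assume "yields c (\<lambda>t s'. yields d (\<lambda>u. Q (t + u)) s') s"
  then obtain t b s' u b' s'' where
    "exec c s t b s'" "b \<le> space_bound" "exec d s' u b' s''" "b' \<le> space_bound" "Q (t + u) s''"
    unfolding yields_def by blast
  then show ?thesis unfolding yields_def
    by (intro exI[of _ "t + u"] exI[of _ "max b b'"] exI[of _ s'']) (auto intro: exec.Seq)
qed

lemma yields_If:
  assumes "testval s q \<Longrightarrow> yields c (\<lambda>t. Q (1 + t)) s" "\<not> testval s q \<Longrightarrow> yields d (\<lambda>t. Q (1 + t)) s"
  shows "yields (IF q THEN c ELSE d) Q s"
  using assms unfolding yields_def by (cases "testval s q") (blast intro: exec.IfTrue exec.IfFalse)+

text \<open>\<open>P k\<close> is a time budget, the measure \<open>k\<close> ensures termination.\<close>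

lemma yields_While:
  fixes P :: "nat \<Rightarrow> real"
  assumes "I k s" and fits: "\<And>k s. I k s \<Longrightarrow> fits s"
    and body: "\<And>k s. I k s \<Longrightarrow> testval s q \<Longrightarrow>
      yields c (\<lambda>t s'. \<exists>k'<k. I k' s' \<and> real t + 1 + P k' \<le> P k) s"
    and exit: "\<And>k s. I k s \<Longrightarrow> \<not> testval s q \<Longrightarrow> 1 \<le> P k"
  shows "yields (WHILE q DO c) (\<lambda>t s'. real t \<le> P k \<and> \<not> testval s' q \<and> (\<exists>k. I k s')) s"
  using assms(1)
proof (induction k arbitrary: s rule: less_induct)
  case (less k)
  show ?case
  proof (cases "testval s q")
    case False
    have "real 1 \<le> P k" using exit[OF less.prems False] by simp
    then show ?thesis unfolding yields_def
      using less.prems False fits_state_bits[OF fits[OF less.prems]] exec.WhileFalse[OF False] by blast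
  next
    case True
    from body[OF less.prems True] obtain t b s' k' where
      1: "exec c s t b s'" "b \<le> space_bound" "k' < k" "I k' s'" "real t + 1 + P k' \<le> P k"
      unfolding yields_def by blast
    from less.IH[OF 1(3,4)] obtain u b' s'' where
      2: "exec (WHILE q DO c) s' u b' s''" "b' \<le> space_bound" "real u \<le> P k'" "\<not> testval s'' q" "\<exists>k. I k s''"
      unfolding yields_def by blast
    have "real (1 + t + u) \<le> P k" "max b b' \<le> space_bound" using 1(2,5) 2(2,3) by simp_all
    then show ?thesis unfolding yields_def
      using 2(4,5) exec.WhileTrue[OF True 1(1) 2(1)] by blast
  qed
qed

text \<open>Four units are spent when the candidate wins: read, test, copy and write. The new entry
  is at most the old one and hence stays within \<open>cell_bound\<close>, however large
  \<open>c\<close> is.\<close>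

lemma yields_minimize:
  assumes "fits s" "array s = tab N g" "val s r = int i" "r \<noteq> R_w" "1 \<le> i" "i \<le> N" "val s R_c = int c"
    and "\<And>t s' w. fits s' \<Longrightarrow> t \<le> 4 \<Longrightarrow> val s' = (val s)(R_w := w) \<Longrightarrow>
      array s' = tab N (g(i := min (g i) c)) \<Longrightarrow> Q t s'"
  shows "yields (minimize r) Q s"
proof -
  have gi: "g i \<le> cell_bound" by (rule fits_cell[OF assms(1,2,5,6)])
  moreover have "cell_bound \<le> reg_bound" using cell_bound_le by (simp add: reg_bound_def)
  ultimately have "g i \<le> reg_bound" by simp
  moreover have "c \<le> reg_bound" using fits_val[OF assms(1), of R_c] assms(7) by simp
  ultimately show ?thesis
    unfolding minimize_def using assms(1-7) gi
    by (intro yields_Seq yields_Assign yields_If yields_Skip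
        yields_Write[where g = g and i = i and v = "min (g i) c"] assms(8)) 
      (simp_all add: min_def)
qed

text \<open>The loop preserves \<open>v * E k = E x\<close>, where \<open>v\<close> is the partial
  product and \<open>k\<close> the remaining argument. A pass takes 3 units and lowers
  \<open>k\<close> by 3, so \<open>3 * x + 1\<close> is ample for the loop; 3 more pay for the first
  test, the initial copy and the last product.\<close>

lemma yields_compute_E:
  assumes "fits s" "r \<noteq> R_x" "val s R_x = int x" "E x \<le> reg_bound"
    and "\<And>t s' y. fits s' \<Longrightarrow> t \<le> 3 * x + 4 \<Longrightarrow> val s' = (val s)(R_x := y, r := int (E x)) \<Longrightarrow>
      array s' = array s \<Longrightarrow> Q t s'"
  shows "yields (compute_E r) Q s"
proof -
  let ?I = "\<lambda>k s'. fits s' \<and> 1 \<le> k \<and> k \<le> x \<and>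
    (\<exists>v. v * E k = E x \<and> val s' = (val s)(R_x := int k, r := int v)) \<and> array s' = array s"
  have reg: "1 \<le> reg_bound" using reg_bound_ge(3) by (simp add: reg_bound_def)
  have loop: "yields (WHILE C 4 [<] V R_x DO (r ::= V r [*] C 3;; R_x ::= V R_x [-] C 3))
    (\<lambda>t s'. real t \<le> 3 * real x + 1 \<and> \<not> testval s' (C 4 [<] V R_x) \<and> (\<exists>k. ?I k s')) s1" if "?I x s1" for s1
    using that
  proof (rule yields_While)
    fix k s' assume I: "?I k s'" and test: "testval s' (C 4 [<] V R_x)"
    then obtain v where y: "fits s'" "1 \<le> k" "k \<le> x" "v * E k = E x" "val s' = (val s)(R_x := int k, r := int v)" "array s' = array s"
      by blast
    have k: "4 < k" using test y(5) assms(2) by simp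
    have Ek: "E k = 3 * E (k - 3)" using E_rec[of "k - 3"] k by simp
    \<comment> \<open>The cofactor \<open>E (k - 3)\<close> is at least 1, so the enlarged partial
      product is at most \<open>E x\<close> and fits into a register.\<close>
    have "v * 3 * 1 \<le> v * 3 * E (k - 3)" using E_pos by (intro mult_le_mono2)
    also have "\<dots> \<le> reg_bound" using assms(4) y(4) Ek by simp
    finally have v: "v * 3 \<le> reg_bound" by simp
    have xb: "k \<le> reg_bound" using fits_val[OF y(1), of R_x] y(5) assms(2) by simp
    have v3: "v * 3 * E (k - 3) = E x" using y(4) Ek by simp
    have decr: "\<exists>k'<k. ?I k' s'' \<and> real (1 + 1) + 1 + (3 * real k' + 1) \<le> 3 * real k + 1"
      if "fits s''" "val s'' = (val s)(R_x := int (k - 3), r := int (v * 3))" "array s'' = array s" for s''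
      using that v3 k y(3) by (intro exI[of _ "k - 3"] conjI exI[of _ "v * 3"]) (auto simp: of_nat_diff)
    show "yields (r ::= V r [*] C 3;; R_x ::= V R_x [-] C 3)
      (\<lambda>t s'. \<exists>k'<k. ?I k' s' \<and> real t + 1 + (3 * real k' + 1) \<le> 3 * real k + 1) s'"
      by (intro yields_Seq yields_Assign decr)
        (use y(1,5,6) v xb k assms(2) in \<open>simp_all add: of_nat_diff fun_upd_twist\<close>)
  next
    show "fits s'" if "?I k s'" for k s' using that by blast
  next
    show "1 \<le> 3 * real k + 1" for k by simp
  qed
  show ?thesis
  proof (cases "x = 0")
    case True
    show ?thesis unfolding compute_E_def
      by (intro yields_If yields_Assign assms(5)[where y = 0])
        (use True assms(1-3) reg in \<open>simp_all add: fun_upd_idem fun_eq_iff\<close>)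
  next
    case False
    have final: "yields (r ::= V r [*] V R_x) (\<lambda>u. Q (1 + (1 + (t + u)))) s'"
      if H: "real t \<le> 3 * real x + 1 \<and> \<not> testval s' (C 4 [<] V R_x) \<and> (\<exists>k. ?I k s')" for t s'
    proof -
      obtain k v where y: "fits s'" "1 \<le> k" "k \<le> x" "v * E k = E x" "val s' = (val s)(R_x := int k, r := int v)" "array s' = array s"
        using H by blast
      have t: "t \<le> 3 * x + 1" using H by linarith
      \<comment> \<open>The loop ends with \<open>1 \<le> k \<le> 4\<close>, where
        \<open>E k = k\<close>; multiplying by \<open>R_x\<close> therefore completes
        \<open>E x\<close>.\<close>
      have "k \<le> 4" using H y(5) assms(2) by simp
      then have "E k = k" using le_4_cases[of k] y(2) by auto
      then have "v * k = E x" using y(4) by simp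
      then have vk: "int v * int k = int (E x)" by (simp flip: of_nat_mult)
      show ?thesis
        by (intro yields_Assign assms(5)[where y = "int k"])
          (use y t vk assms in \<open>simp_all add: fun_upd_twist\<close>)
    qed
    have start: "?I x s1" if "fits s1" "val s1 = (val s)(r := 1)" "array s1 = array s" for s1
      using that assms(2,3) False by (intro conjI exI[of _ 1]) (simp_all add: fun_eq_iff)
    show ?thesis unfolding compute_E_def
      by (intro yields_If yields_Seq yields_Assign yields_mono[OF loop[OF start]] final)
        (use False assms(1-3) reg in simp_all)
  qed
qed

section \<open>Runs of the steps of the algorithm\<close>

definition here :: "nat \<Rightarrow> (nat \<Rightarrow> nat) \<Rightarrow> state \<Rightarrow> bool" where
  "here n g s \<longleftrightarrow> fits s \<and> val s R_N = int N \<and> val s R_n = int n \<and> array s = tab N g"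

lemma yields_step1:
  assumes "here n g s" "2 \<le> n" "n \<le> N"
  shows "yields step1 (\<lambda>t s'. t \<le> 7 \<and> here n (g(n := min (g n) (g (n - 1) + 1))) s') s"
proof -
  have s: "fits s" "val s R_N = int N" "val s R_n = int n" "array s = tab N g"
    using assms(1) by (simp_all add: here_def)
  have i: "tab N g (int n - 1) = Some (int (g (n - 1)))"
    using tab_int[of "n - 1" N g] assms(2,3) by (simp add: of_nat_diff)
  have "g (n - 1) \<le> cell_bound" using fits_cell[OF s(1,4), of "n - 1"] assms(2,3) by simp
  moreover have "4 * cell_bound \<le> reg_bound" "1 \<le> cell_bound"
    using cell_bound_le by (simp_all add: reg_bound_def cell_bound_def)
  moreover have "4 * N \<le> reg_bound" using reg_bound_ge(1) by (simp add: reg_bound_def)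
  ultimately have b: "g (n - 1) \<le> reg_bound" "g (n - 1) + 1 \<le> reg_bound" "n \<le> reg_bound"
    using assms(3) by linarith+
  show ?thesis unfolding step1_def
    by (intro yields_Seq yields_Assign yields_minimize[where g = g and i = n and c = "g (n - 1) + 1"])
      (use s b i assms(2,3) in \<open>simp_all add: here_def\<close>)
qed

text \<open>The two calls of \<open>compute_E\<close> take at most \<open>3 * t + 4\<close> and
  \<open>3 * (T - t) + 4\<close> units. With three assignments this gives a bound that does not
  depend on \<open>t\<close>.\<close>

lemma yields_evaluate_guard:
  assumes "fits s" "val s R_t = int t" "val s R_T = int T" "t \<le> T" "2 * E T \<le> reg_bound" "T \<le> reg_bound"
    and "\<And>u s'. fits s' \<Longrightarrow> u \<le> 3 * T + 11 \<Longrightarrow> (\<forall>r. r \<notin> {R_x, R_e, R_f, R_w} \<longrightarrow> val s' r = val s r) \<Longrightarrow>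
      val s' R_w = int (E t + E (T - t)) \<Longrightarrow> array s' = array s \<Longrightarrow> Q u s'"
  shows "yields evaluate_guard Q s"
proof -
  have "E t \<le> E T" "E (T - t) \<le> E T" using assms(4) by (auto intro: E_mono)
  then have E: "E t \<le> reg_bound" "E (T - t) \<le> reg_bound" "E t + E (T - t) \<le> reg_bound" using assms(5) by linarith+
  show ?thesis unfolding evaluate_guard_def
    by (intro yields_Seq yields_Assign yields_compute_E[where x = t] yields_compute_E[where x = "T - t"] assms(7))
      (use E assms(1-6) in \<open>simp_all add: of_nat_diff\<close>)
qed

text \<open>At most \<open>T div 2\<close> passes, each of cost linear in \<open>T\<close>, give the
  quadratic bound. The last clause, that every skipped \<open>u\<close> failed the guard, is the
  hypothesis on \<open>t\<close> in \<open>complexity_attained\<close>.\<close>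

lemma yields_step2:
  assumes s: "here n g s" and n: "2 \<le> n" "n \<le> N" and T: "g (n - 1) = T" "T = \<parallel>n - 1\<parallel>"
  shows "yields step2 (\<lambda>u s'. \<exists>t. u \<le> 20 * (T + 1) ^ 2 \<and> here n g s' \<and> val s' R_kMax = int (E t) \<and>
    t \<le> T div 2 \<and> n \<le> E t + E (T - t) \<and> (\<forall>u. t < u \<longrightarrow> u \<le> T div 2 \<longrightarrow> E u + E (T - u) < n)) s"
proof -
  have E: "E T \<le> (n - 1) ^ 2" "n - 1 \<le> E T"
    using E_complexity_le[of "n - 1"] le_E_complexity[of "n - 1"] n T by simp_all
  have "(n - 1) ^ 2 \<le> N ^ 2" using n by (intro power_mono) auto
  then have ET: "2 * E T \<le> reg_bound" using E(1) reg_bound_ge(2) unfolding reg_bound_def by linarith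
  have "T \<le> cell_bound" using fits_cell[of s g "n - 1"] s n T by (simp add: here_def)
  then have TK: "T \<le> reg_bound" using cell_bound_le by (simp add: reg_bound_def)
  have Tn: "tab N g (int n - 1) = Some (int T)"
    using tab_int[of "n - 1" N g] n T by (simp add: of_nat_diff)
  have nK: "n \<le> reg_bound" using n reg_bound_ge(1) by (simp add: reg_bound_def)
  define I where "I k s' \<longleftrightarrow> here n g s' \<and> val s' R_T = int T \<and> val s' R_t = int k \<and> k \<le> T div 2 \<and>
    val s' R_w = int (E k + E (T - k)) \<and> (\<forall>u. k < u \<longrightarrow> u \<le> T div 2 \<longrightarrow> E u + E (T - u) < n)" for k s'
  have loop: "yields (WHILE V R_w [<] V R_n DO (R_t ::= V R_t [-] C 1;; evaluate_guard))
    (\<lambda>u s'. real u \<le> real (T div 2) * (3 * real T + 13) + 1 \<and> \<not> testval s' (V R_w [<] V R_n) \<and> (\<exists>k. I k s')) s1"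
    if "I (T div 2) s1" for s1
    using that
  proof (rule yields_While[where P = "\<lambda>k. real k * (3 * real T + 13) + 1"])
    fix k s' assume I: "I k s'" and test: "testval s' (V R_w [<] V R_n)"
    have less: "E k + E (T - k) < n" using I test by (simp add: I_def here_def)
    \<comment> \<open>The search stops at 0 at the latest: the guard value there is
      \<open>E 0 + E T = 1 + E T\<close>, and \<open>n - 1 \<le> E T\<close>.\<close>
    have "k \<noteq> 0"
    proof
      assume "k = 0"
      then have "E T + 1 < n" using less by simp
      then show False using E(2) n by simp
    qed
    moreover have "k \<le> T div 2" using I by (simp add: I_def)
    ultimately have k: "1 \<le> k" "k \<le> T" by simp_all
    have decr: "\<exists>k'<k. I k' s'' \<and> real (1 + u) + 1 + (real k' * (3 * real T + 13) + 1) \<le> real k * (3 * real T + 13) + 1"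
      if "here n g s''" "val s'' R_T = int T" "val s'' R_t = int (k - 1)" "u \<le> 3 * T + 11"
        "val s'' R_w = int (E (k - 1) + E (T - (k - 1)))" for u s''
    proof (intro exI[of _ "k - 1"] conjI)
      have "E u + E (T - u) < n" if "k - 1 < u" "u \<le> T div 2" for u
        using that less I k by (cases "u = k") (auto simp: I_def)
      then show "I (k - 1) s''" using that I k by (auto simp: I_def)
      show "real (1 + u) + 1 + (real (k - 1) * (3 * real T + 13) + 1) \<le> real k * (3 * real T + 13) + 1"
        using that(4) k(1) by (cases k) (simp_all add: algebra_simps)
    qed (use k in simp)
    show "yields (R_t ::= V R_t [-] C 1;; evaluate_guard)
        (\<lambda>t s'. \<exists>k'<k. I k' s' \<and> real t + 1 + (real k' * (3 * real T + 13) + 1) \<le> real k * (3 * real T + 13) + 1) s'"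
      by (intro yields_Seq yields_Assign yields_evaluate_guard[where t = "k - 1" and T = T] decr)
        (use I k ET TK in \<open>simp_all add: I_def here_def of_nat_diff\<close>)
  next
    show "fits s'" if "I k s'" for k s' using that by (simp add: I_def here_def)
  next
    show "1 \<le> real k * (3 * real T + 13) + 1" for k by simp
  qed
  have start: "I (T div 2) s1"
    if "here n g s1" "val s1 R_T = int T" "val s1 R_t = int (T div 2)"
        "val s1 R_w = int (E (T div 2) + E (T - T div 2))" for s1
    using that by (simp add: I_def)
  have final: "yields (R_x ::= Copy (V R_t);; compute_E R_kMax)
     (\<lambda>v s'. \<exists>t. 1 + (1 + (1 + (u + (t1 + v)))) \<le> 20 * (T + 1) ^ 2 \<and> here n g s' \<and> val s' R_kMax = int (E t) \<and>
        t \<le> T div 2 \<and> n \<le> E t + E (T - t) \<and> (\<forall>u. t < u \<longrightarrow> u \<le> T div 2 \<longrightarrow> E u + E (T - u) < n)) s'"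
    if u: "u \<le> 3 * T + 11" and H: "real t1 \<le> real (T div 2) * (3 * real T + 13) + 1 \<and> \<not> testval s' (V R_w [<] V R_n) \<and> (\<exists>k. I k s')" for u t1 s'
  proof -
    obtain k where k: "I k s'" using H by blast
    then have k': "here n g s'" "val s' R_t = int k" "k \<le> T div 2" "\<forall>u. k < u \<longrightarrow> u \<le> T div 2 \<longrightarrow> E u + E (T - u) < n"
      by (auto simp: I_def)
    have nk: "n \<le> E k + E (T - k)" using H k by (auto simp: I_def here_def)
    have "E k \<le> E T" using k'(3) by (intro E_mono) simp
    then have Ek: "E k \<le> reg_bound" using ET by simp
    have kK: "k \<le> reg_bound" using k'(3) TK by simp
    have "real t1 \<le> real (T div 2 * (3 * T + 13) + 1)" using H by simp
    then have "t1 \<le> T div 2 * (3 * T + 13) + 1" by (simp only: of_nat_le_iff)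
    also have "\<dots> \<le> T * (3 * T + 13) + 1" by (intro add_right_mono mult_le_mono1) simp
    finally have t1: "t1 \<le> 3 * T ^ 2 + 13 * T + 1" by (simp add: power2_eq_square algebra_simps)
    have time: "1 + (1 + (1 + (u + (t1 + (1 + v))))) \<le> 20 * (T + 1) ^ 2" if "v \<le> 3 * k + 4" for v
    proof -
      have "1 + (1 + (1 + (u + (t1 + (1 + v))))) \<le> 3 * T ^ 2 + 19 * T + 20" using u t1 that k'(3) by linarith
      also have "\<dots> \<le> 20 * (T + 1) ^ 2" by (simp add: power2_eq_square algebra_simps)
      finally show ?thesis .
    qed
    show ?thesis
      by (intro yields_Seq yields_Assign yields_compute_E[where x = k] exI[of _ k])
        (use k' nk Ek kK time in \<open>simp_all add: here_def\<close>)
  qed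
  show ?thesis unfolding step2_def
    by (intro yields_Seq yields_Assign yields_evaluate_guard[where t = "T div 2" and T = T]
        yields_mono[OF loop[OF start]] final)
      (use s ET TK Tn nK n in \<open>simp_all add: here_def zdiv_int\<close>)
qed

text \<open>Because \<open>kMax < n\<close>, the entries read at \<open>m\<close> and
  \<open>n - m\<close> lie below \<open>n\<close> and are final; only the entry at \<open>n\<close>
  changes. A pass costs at most 10: the test, five assignments and \<open>minimize\<close>.\<close>

lemma yields_step3:
  assumes s: "here n g s" and n: "2 \<le> n" "n \<le> N" and kMax: "val s R_kMax = int kMax" "kMax < n"
    and g: "\<forall>i. 1 \<le> i \<and> i < n \<longrightarrow> g i = \<parallel>i\<parallel>" "\<parallel>n\<parallel> \<le> g n"
  shows "yields step3 (\<lambda>t s'. t \<le> 10 * kMax + 2 \<and> (\<exists>v. here n (g(n := v)) s' \<and> \<parallel>n\<parallel> \<le> v \<and> v \<le> g n \<and>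
    (\<forall>m. 6 \<le> m \<and> m \<le> kMax \<longrightarrow> v \<le> \<parallel>m\<parallel> + \<parallel>n - m\<parallel>))) s"
proof -
  have b: "4 * cell_bound \<le> reg_bound" "4 * N \<le> reg_bound" "8 * 4 \<le> reg_bound"
    using cell_bound_le reg_bound_ge(1,4) n by (simp_all add: reg_bound_def)
  \<comment> \<open>Here \<open>v\<close> is the current entry at \<open>n\<close>. By truncated
    subtraction the measure is 0 from the start if \<open>kMax < 6\<close>.\<close>
  define I where "I k s' \<longleftrightarrow> (\<exists>m v. k = kMax + 1 - m \<and> 6 \<le> m \<and> val s' R_m = int m \<and> val s' R_kMax = int kMax \<and>
    here n (g(n := v)) s' \<and> \<parallel>n\<parallel> \<le> v \<and> v \<le> g n \<and> (\<forall>j. 6 \<le> j \<and> j < m \<and> j \<le> kMax \<longrightarrow> v \<le> \<parallel>j\<parallel> + \<parallel>n - j\<parallel>))" for k s'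
  have start: "I (kMax + 1 - 6) s'" if "here n g s'" "val s' R_m = 6" "val s' R_kMax = int kMax" for s'
    unfolding I_def using that g(2) by (intro exI[of _ 6] exI[of _ "g n"]) simp
  have loop: "yields (WHILE V R_m [\<le>] V R_kMax DO (
       R_i ::= V R_n [-] V R_m;;
       R_a ::= Compl[V R_m];;
       R_b ::= Compl[V R_i];;
       R_c ::= V R_a [+] V R_b;;
       minimize R_n;;
       R_m ::= V R_m [+] C 1))
    (\<lambda>u s'. real u \<le> 10 * real (kMax + 1 - 6) + 1 \<and> \<not> testval s' (V R_m [\<le>] V R_kMax) \<and> (\<exists>k. I k s')) s1"
    if "I (kMax + 1 - 6) s1" for s1
    using that
  proof (rule yields_While[where P = "\<lambda>k. 10 * real k + 1"])
    fix k s' assume I: "I k s'" and test: "testval s' (V R_m [\<le>] V R_kMax)"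
    obtain m v where m: "k = kMax + 1 - m" "6 \<le> m" "val s' R_m = int m" "val s' R_kMax = int kMax"
      "here n (g(n := v)) s'" "\<parallel>n\<parallel> \<le> v" "v \<le> g n" "\<forall>j. 6 \<le> j \<and> j < m \<and> j \<le> kMax \<longrightarrow> v \<le> \<parallel>j\<parallel> + \<parallel>n - j\<parallel>"
      using I unfolding I_def by blast
    have mk: "m \<le> kMax" using test m(3,4) by simp
    have mn: "m < n" "1 \<le> n - m" "n - m < n" using mk kMax(2) m(2) by simp_all
    have s': "fits s'" "val s' R_n = int n" "val s' R_N = int N" "array s' = tab N (g(n := v))"
      using m(5) by (simp_all add: here_def)
    have gm: "g m = \<parallel>m\<parallel>" "g (n - m) = \<parallel>n - m\<parallel>" using g(1) mn m(2) by simp_all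
    have cells: "tab N (g(n := v)) (int m) = Some (int \<parallel>m\<parallel>)" "tab N (g(n := v)) (int n - int m) = Some (int \<parallel>n - m\<parallel>)"
      using tab_int[of m N "g(n := v)"] tab_int[of "n - m" N "g(n := v)"] mn m(2) n(2) gm by (simp_all add: of_nat_diff)
    have "\<parallel>m\<parallel> \<le> cell_bound" "\<parallel>n - m\<parallel> \<le> cell_bound"
      using fits_cell[OF s'(1,4), of m] fits_cell[OF s'(1,4), of "n - m"] mn m(2) n(2) gm by simp_all
    then have bd: "\<parallel>m\<parallel> \<le> reg_bound" "\<parallel>n - m\<parallel> \<le> reg_bound" "\<parallel>m\<parallel> + \<parallel>n - m\<parallel> \<le> reg_bound"
      "n \<le> reg_bound" "m + 1 \<le> reg_bound" using b n mn by linarith+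
    have "\<parallel>n\<parallel> \<le> \<parallel>m\<parallel> + \<parallel>n - m\<parallel>" using complexity_add_le[of m "n - m"] mn m(2) by simp
    then have decr: "\<exists>k'<k. I k' s'' \<and> real (1 + (1 + (1 + (1 + (t + 1))))) + 1 + (10 * real k' + 1) \<le> 10 * real k + 1"
      if "t \<le> 4" "here n (g(n := min v (\<parallel>m\<parallel> + \<parallel>n - m\<parallel>))) s''" "val s'' R_m = int (m + 1)" "val s'' R_kMax = int kMax" for t s''
      unfolding I_def using that m mk
      by (intro exI[of _ "kMax - m"] conjI exI[of _ "m + 1"] exI[of _ "min v (\<parallel>m\<parallel> + \<parallel>n - m\<parallel>)"])
        (auto simp: of_nat_diff less_Suc_eq min_le_iff_disj)
    show "yields (R_i ::= V R_n [-] V R_m;; R_a ::= Compl[V R_m];; R_b ::= Compl[V R_i];;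
       R_c ::= V R_a [+] V R_b;; minimize R_n;; R_m ::= V R_m [+] C 1)
        (\<lambda>t s'. \<exists>k'<k. I k' s' \<and> real t + 1 + (10 * real k' + 1) \<le> 10 * real k + 1) s'"
      by (intro yields_Seq yields_Assign
           yields_minimize[where g = "g(n := v)" and i = n and c = "\<parallel>m\<parallel> + \<parallel>n - m\<parallel>"] decr)
        (use s' m(3,4) cells bd n mn in \<open>simp_all add: here_def\<close>)
  next
    show "fits s'" if "I k s'" for k s' using that by (auto simp: I_def here_def)
  next
    show "1 \<le> 10 * real k + 1" for k by simp
  qed
  have final: "1 + u \<le> 10 * kMax + 2 \<and> (\<exists>v. here n (g(n := v)) s' \<and> \<parallel>n\<parallel> \<le> v \<and> v \<le> g n \<and>
    (\<forall>m. 6 \<le> m \<and> m \<le> kMax \<longrightarrow> v \<le> \<parallel>m\<parallel> + \<parallel>n - m\<parallel>))"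
    if H: "real u \<le> 10 * real (kMax + 1 - 6) + 1 \<and> \<not> testval s' (V R_m [\<le>] V R_kMax) \<and> (\<exists>k. I k s')" for u s'
  proof (intro conjI)
    have "real u \<le> real (10 * (kMax + 1 - 6) + 1)" using H by simp
    then have "u \<le> 10 * (kMax + 1 - 6) + 1" by (simp only: of_nat_le_iff)
    then show "1 + u \<le> 10 * kMax + 2" by simp
    obtain k m v where m: "k = kMax + 1 - m" "6 \<le> m" "val s' R_m = int m" "val s' R_kMax = int kMax"
      "here n (g(n := v)) s'" "\<parallel>n\<parallel> \<le> v" "v \<le> g n" "\<forall>j. 6 \<le> j \<and> j < m \<and> j \<le> kMax \<longrightarrow> v \<le> \<parallel>j\<parallel> + \<parallel>n - j\<parallel>"
      using H unfolding I_def by blast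
    have "kMax < m" using H m(3,4) by simp
    then show "\<exists>v. here n (g(n := v)) s' \<and> \<parallel>n\<parallel> \<le> v \<and> v \<le> g n \<and>
      (\<forall>m. 6 \<le> m \<and> m \<le> kMax \<longrightarrow> v \<le> \<parallel>m\<parallel> + \<parallel>n - m\<parallel>)" using m by (intro exI[of _ v]) auto
  qed
  show ?thesis unfolding step3_def
    by (intro yields_Seq yields_Assign yields_mono[OF loop[OF start]] final)
      (use s kMax(1) b in \<open>simp_all add: here_def\<close>)
qed

text \<open>All writes go to some \<open>m * n\<close> with \<open>m \<ge> 2\<close>, hence beyond
  \<open>n\<close>, while all reads that supply the summands stay at or below \<open>n\<close>. The
  final values are therefore not disturbed.\<close>

lemma yields_step4:
  assumes s: "here n g s" and n: "2 \<le> n" "n \<le> N"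
    and g: "\<forall>i. 1 \<le> i \<and> i \<le> n \<longrightarrow> g i = \<parallel>i\<parallel>" "\<forall>i. 1 \<le> i \<and> i \<le> N \<longrightarrow> \<parallel>i\<parallel> \<le> g i"
  shows "yields step4 (\<lambda>t s'. t \<le> 10 * (N div n) + 5 \<and> (\<exists>g'. here n g' s' \<and>
    (\<forall>i. 1 \<le> i \<and> i \<le> N \<longrightarrow> \<parallel>i\<parallel> \<le> g' i \<and> g' i \<le> g i) \<and> (\<forall>i. i \<le> n \<longrightarrow> g' i = g i) \<and>
    (\<forall>j. 2 \<le> j \<and> j \<le> n \<and> j * n \<le> N \<longrightarrow> g' (j * n) \<le> \<parallel>j\<parallel> + \<parallel>n\<parallel>))) s"
proof -
  have b: "4 * cell_bound \<le> reg_bound" "4 * N \<le> reg_bound" "8 * 4 \<le> reg_bound"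
    using cell_bound_le reg_bound_ge(1,4) n by (simp_all add: reg_bound_def)
  define q where "q = min n (N div n)"
  have q: "q \<le> n" "q \<le> N div n" by (simp_all add: q_def)
  define I where "I k s' \<longleftrightarrow> (\<exists>m g'. k = q + 1 - m \<and> 2 \<le> m \<and> val s' R_k = int m \<and> val s' R_q = int q \<and>
    here n g' s' \<and> (\<forall>i. 1 \<le> i \<and> i \<le> N \<longrightarrow> \<parallel>i\<parallel> \<le> g' i \<and> g' i \<le> g i) \<and> (\<forall>i. i \<le> n \<longrightarrow> g' i = g i) \<and>
    (\<forall>j. 2 \<le> j \<and> j < m \<and> j \<le> q \<longrightarrow> g' (j * n) \<le> \<parallel>j\<parallel> + \<parallel>n\<parallel>))" for k s'
  have start: "I (q + 1 - 2) s'" if "here n g s'" "val s' R_k = 2" "val s' R_q = int q" for s'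
    unfolding I_def using that g(2) by (intro exI[of _ 2] exI[of _ g]) simp
  have loop: "yields (WHILE V R_k [\<le>] V R_q DO (
       R_p ::= V R_k [*] V R_n;;
       R_a ::= Compl[V R_k];;
       R_b ::= Compl[V R_n];;
       R_c ::= V R_a [+] V R_b;;
       minimize R_p;;
       R_k ::= V R_k [+] C 1))
    (\<lambda>u s'. real u \<le> 10 * real (q + 1 - 2) + 1 \<and> \<not> testval s' (V R_k [\<le>] V R_q) \<and> (\<exists>k. I k s')) s1"
    if "I (q + 1 - 2) s1" for s1
    using that
  proof (rule yields_While[where P = "\<lambda>k. 10 * real k + 1"])
    fix k s' assume I: "I k s'" and test: "testval s' (V R_k [\<le>] V R_q)"
    obtain m g' where m: "k = q + 1 - m" "2 \<le> m" "val s' R_k = int m" "val s' R_q = int q" "here n g' s'"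
      and g': "\<forall>i. 1 \<le> i \<and> i \<le> N \<longrightarrow> \<parallel>i\<parallel> \<le> g' i \<and> g' i \<le> g i" "\<forall>i. i \<le> n \<longrightarrow> g' i = g i"
        "\<forall>j. 2 \<le> j \<and> j < m \<and> j \<le> q \<longrightarrow> g' (j * n) \<le> \<parallel>j\<parallel> + \<parallel>n\<parallel>"
      using I unfolding I_def by blast
    have mq: "m \<le> q" using test m(3,4) by simp
    have "m \<le> N div n" using mq q(2) by (rule order_trans)
    then have mn: "m \<le> n" "m * n \<le> N" using mq q(1) n by (simp_all add: less_eq_div_iff_mult_less_eq)
    have large: "n < m * n" "1 \<le> m * n" using m(2) n by simp_all
    have s': "fits s'" "val s' R_n = int n" "val s' R_N = int N" "array s' = tab N g'"
      using m(5) by (simp_all add: here_def)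
    have gm: "g' m = \<parallel>m\<parallel>" "g' n = \<parallel>n\<parallel>" using g'(2) g(1) mn m(2) n by simp_all
    have cells: "tab N g' (int m) = Some (int \<parallel>m\<parallel>)" "tab N g' (int n) = Some (int \<parallel>n\<parallel>)"
      using tab_int[of m N g'] tab_int[of n N g'] mn m(2) n gm by simp_all
    have "\<parallel>m\<parallel> \<le> cell_bound" "\<parallel>n\<parallel> \<le> cell_bound"
      using fits_cell[OF s'(1,4), of m] fits_cell[OF s'(1,4), of n] mn m(2) n gm by simp_all
    then have bd: "\<parallel>m\<parallel> \<le> reg_bound" "\<parallel>n\<parallel> \<le> reg_bound" "\<parallel>m\<parallel> + \<parallel>n\<parallel> \<le> reg_bound" "m + 1 \<le> reg_bound" "m * n \<le> reg_bound"
      using b n mn by linarith+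
    have bd': "int m * int n \<le> int reg_bound" using bd(5) by (simp flip: of_nat_mult)
    define g'' where "g'' = g'(m * n := min (g' (m * n)) (\<parallel>m\<parallel> + \<parallel>n\<parallel>))"
    have "\<parallel>m * n\<parallel> \<le> \<parallel>m\<parallel> + \<parallel>n\<parallel>" using complexity_mult_le[of m n] n m(2) by simp
    then have 1: "\<forall>i. 1 \<le> i \<and> i \<le> N \<longrightarrow> \<parallel>i\<parallel> \<le> g'' i \<and> g'' i \<le> g i"
      using g'(1) by (auto simp: g''_def min_le_iff_disj)
    have 2: "\<forall>i. i \<le> n \<longrightarrow> g'' i = g i" using g'(2) large by (auto simp: g''_def)
    have 3: "\<forall>j. 2 \<le> j \<and> j < m + 1 \<and> j \<le> q \<longrightarrow> g'' (j * n) \<le> \<parallel>j\<parallel> + \<parallel>n\<parallel>"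
      using g'(3) n by (auto simp: g''_def less_Suc_eq min_le_iff_disj)
    have decr: "\<exists>k'<k. I k' s'' \<and> real (1 + (1 + (1 + (1 + (t + 1))))) + 1 + (10 * real k' + 1) \<le> 10 * real k + 1"
      if "t \<le> 4" "here n g'' s''" "val s'' R_k = int (m + 1)" "val s'' R_q = int q" for t s''
    proof (intro exI[of _ "q - m"] conjI)
      show "I (q - m) s''" unfolding I_def
        using that m(2) 1 2 3 by (intro exI[of _ "m + 1"] exI[of _ g''] conjI) simp_all
    qed (use m(1) mq that(1) in \<open>simp_all add: of_nat_diff\<close>)
    show "yields (R_p ::= V R_k [*] V R_n;; R_a ::= Compl[V R_k];; R_b ::= Compl[V R_n];;
       R_c ::= V R_a [+] V R_b;; minimize R_p;; R_k ::= V R_k [+] C 1)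
        (\<lambda>t s'. \<exists>k'<k. I k' s' \<and> real t + 1 + (10 * real k' + 1) \<le> 10 * real k + 1) s'"
      by (intro yields_Seq yields_Assign
           yields_minimize[where g = g' and i = "m * n" and c = "\<parallel>m\<parallel> + \<parallel>n\<parallel>"] decr)
        (use s' m(3,4) cells bd bd' mn(2) large(2) in \<open>simp_all add: here_def g''_def\<close>)
  next
    show "fits s'" if "I k s'" for k s' using that by (auto simp: I_def here_def)
  next
    show "1 \<le> 10 * real k + 1" for k by simp
  qed
  have final: "1 + (r + (1 + u)) \<le> 10 * (N div n) + 5 \<and> (\<exists>g'. here n g' s' \<and>
    (\<forall>i. 1 \<le> i \<and> i \<le> N \<longrightarrow> \<parallel>i\<parallel> \<le> g' i \<and> g' i \<le> g i) \<and> (\<forall>i. i \<le> n \<longrightarrow> g' i = g i) \<and>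
    (\<forall>j. 2 \<le> j \<and> j \<le> n \<and> j * n \<le> N \<longrightarrow> g' (j * n) \<le> \<parallel>j\<parallel> + \<parallel>n\<parallel>))"
    if H: "real u \<le> 10 * real (q + 1 - 2) + 1 \<and> \<not> testval s' (V R_k [\<le>] V R_q) \<and> (\<exists>k. I k s')" and r: "r \<le> 2" for r u s'
  proof (intro conjI)
    have "real u \<le> real (10 * (q + 1 - 2) + 1)" using H by simp
    then have "u \<le> 10 * (q + 1 - 2) + 1" by (simp only: of_nat_le_iff)
    then show "1 + (r + (1 + u)) \<le> 10 * (N div n) + 5" using q(2) r by linarith
    obtain k m g' where m: "2 \<le> m" "val s' R_k = int m" "val s' R_q = int q" "here n g' s'"
      and g': "\<forall>i. 1 \<le> i \<and> i \<le> N \<longrightarrow> \<parallel>i\<parallel> \<le> g' i \<and> g' i \<le> g i" "\<forall>i. i \<le> n \<longrightarrow> g' i = g i"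
        "\<forall>j. 2 \<le> j \<and> j < m \<and> j \<le> q \<longrightarrow> g' (j * n) \<le> \<parallel>j\<parallel> + \<parallel>n\<parallel>"
      using H unfolding I_def by blast
    have "q < m" using H m(2,3) by simp
    \<comment> \<open>The loop limit \<open>q = min n (N div n)\<close> misses no admissible
      multiplier.\<close>
    moreover have "j \<le> q" if "j \<le> n" "j * n \<le> N" for j
      using that n by (simp add: q_def less_eq_div_iff_mult_less_eq)
    ultimately have "\<forall>j. 2 \<le> j \<and> j \<le> n \<and> j * n \<le> N \<longrightarrow> g' (j * n) \<le> \<parallel>j\<parallel> + \<parallel>n\<parallel>"
      using g'(3) by (meson le_less_trans)
    then show "\<exists>g'. here n g' s' \<and>
      (\<forall>i. 1 \<le> i \<and> i \<le> N \<longrightarrow> \<parallel>i\<parallel> \<le> g' i \<and> g' i \<le> g i) \<and> (\<forall>i. i \<le> n \<longrightarrow> g' i = g i) \<and>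
      (\<forall>j. 2 \<le> j \<and> j \<le> n \<and> j * n \<le> N \<longrightarrow> g' (j * n) \<le> \<parallel>j\<parallel> + \<parallel>n\<parallel>)"
      using m(4) g'(1,2) by blast
  qed
  have "N div n \<le> N" by simp
  then have "N div n \<le> reg_bound" "n \<le> reg_bound" using b n by linarith+
  then show ?thesis unfolding step4_def
    by (intro yields_Seq yields_Assign yields_If yields_Skip yields_mono[OF loop[OF start]] final)
      (use s n b in \<open>simp_all add: here_def q_def min_def flip: zdiv_int\<close>)
qed

text \<open>The halving loop preserves \<open>l + floor_log p = floor_log (N ^ 3)\<close>, so that
  \<open>R_L\<close> ends with this logarithm and becomes \<open>cell_bound\<close> by the
  increment. Both loops cost 3 units per pass.\<close>

lemma yields_initialize:
  assumes s: "fits s" "val s R_N = int N" "array s = tab N g"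
  shows "yields initialize (\<lambda>t s'. t \<le> 3 * cell_bound + 3 * N + 8 \<and> fits s' \<and> val s' R_N = int N \<and>
    array s' = tab N (\<lambda>i. if i = 1 then 1 else cell_bound)) s"
proof -
  have cb: "cell_bound \<le> N ^ 3" by (rule cell_bound_le)
  have K: "N ^ 3 \<le> reg_bound" "N * N \<le> reg_bound" "N + 1 \<le> reg_bound" "1 \<le> reg_bound" "cell_bound \<le> reg_bound" "1 \<le> cell_bound"
    using cb reg_bound_ge(1,2,3) by (simp_all add: reg_bound_def power2_eq_square cell_bound_def)
  have K': "int N * int N \<le> int reg_bound" "int N * int N * int N \<le> int reg_bound"
    using K(1,2) by (simp_all add: power3_eq_cube flip: of_nat_mult)
  let ?l = "floor_log (N ^ 3)"
  define I where "I k s' \<longleftrightarrow> fits s' \<and> val s' R_N = int N \<and> array s' = tab N g \<and>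
    (\<exists>p l. 1 \<le> p \<and> p \<le> N ^ 3 \<and> val s' R_p = int p \<and> k = floor_log p \<and> l + k = ?l \<and> val s' R_L = int l)" for k s'
  have halve: "yields (WHILE C 1 [<] V R_p DO (R_p ::= V R_p [div] C 2;; R_L ::= V R_L [+] C 1))
    (\<lambda>u s'. real u \<le> 3 * real ?l + 1 \<and> \<not> testval s' (C 1 [<] V R_p) \<and> (\<exists>k. I k s')) s1" if "I ?l s1" for s1
    using that
  proof (rule yields_While[where P = "\<lambda>k. 3 * real k + 1"])
    fix k s' assume I: "I k s'" and test: "testval s' (C 1 [<] V R_p)"
    then obtain p l where s': "fits s'" "val s' R_N = int N" "array s' = tab N g"
      and p: "1 \<le> p" "p \<le> N ^ 3" "val s' R_p = int p" "k = floor_log p" "l + k = ?l" "val s' R_L = int l"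
      unfolding I_def by blast
    have p1: "1 < p" using test p(3) by simp
    then have fl: "k = Suc (floor_log (p div 2))" using floor_log_rec[of p] p(4) by (simp del: floor_log_half)
    have bd: "p div 2 \<le> reg_bound" "l + 1 \<le> reg_bound"
    proof -
      show "p div 2 \<le> reg_bound" using p(2) K(1) by linarith
      show "l + 1 \<le> reg_bound" using p(5) K(5) by (simp add: cell_bound_def)
    qed
    have decr: "\<exists>k'<k. I k' s'' \<and> real (1 + 1) + 1 + (3 * real k' + 1) \<le> 3 * real k + 1"
      if "fits s''" "val s'' R_N = int N" "array s'' = tab N g" "val s'' R_p = int (p div 2)" "val s'' R_L = int (l + 1)" for s''
    proof (intro exI[of _ "floor_log (p div 2)"] conjI)
      show "I (floor_log (p div 2)) s''" unfolding I_def
        using that p p1 fl by (intro conjI exI[of _ "p div 2"] exI[of _ "l + 1"]) (simp_all del: floor_log_half)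
    qed (use fl in \<open>simp_all del: floor_log_half\<close>)
    show "yields (R_p ::= V R_p [div] C 2;; R_L ::= V R_L [+] C 1)
        (\<lambda>t s'. \<exists>k'<k. I k' s' \<and> real t + 1 + (3 * real k' + 1) \<le> 3 * real k + 1) s'"
      by (intro yields_Seq yields_Assign decr) (use s' p(3,6) bd in \<open>simp_all add: zdiv_int\<close>)
  next
    show "fits s'" if "I k s'" for k s' using that by (simp add: I_def)
  next
    show "1 \<le> 3 * real k + 1" for k by simp
  qed
  define J where "J k s' \<longleftrightarrow> fits s' \<and> val s' R_N = int N \<and> val s' R_L = int cell_bound \<and>
    (\<exists>i. 1 \<le> i \<and> i \<le> N + 1 \<and> k = N + 1 - i \<and> val s' R_i = int i \<and>
      array s' = tab N (\<lambda>j. if j < i then cell_bound else g j))" for k s'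
  have fill: "yields (WHILE V R_i [\<le>] V R_N DO (Compl[V R_i] ::= V R_L;; R_i ::= V R_i [+] C 1))
    (\<lambda>u s'. real u \<le> 3 * real N + 1 \<and> \<not> testval s' (V R_i [\<le>] V R_N) \<and> (\<exists>k. J k s')) s1" if "J N s1" for s1
    using that
  proof (rule yields_While[where P = "\<lambda>k. 3 * real k + 1"])
    fix k s' assume J: "J k s'" and test: "testval s' (V R_i [\<le>] V R_N)"
    then obtain i where s': "fits s'" "val s' R_N = int N" "val s' R_L = int cell_bound"
      and i: "1 \<le> i" "i \<le> N + 1" "k = N + 1 - i" "val s' R_i = int i" "array s' = tab N (\<lambda>j. if j < i then cell_bound else g j)"
      unfolding J_def by blast
    have iN: "i \<le> N" using test i(4) s'(2) by simp
    have upd: "(\<lambda>j. if j < i then cell_bound else g j)(i := cell_bound) = (\<lambda>j. if j < i + 1 then cell_bound else g j)"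
      by (auto simp: fun_eq_iff)
    have decr: "\<exists>k'<k. J k' s'' \<and> real (1 + 1) + 1 + (3 * real k' + 1) \<le> 3 * real k + 1"
      if "fits s''" "val s'' R_N = int N" "val s'' R_L = int cell_bound" "val s'' R_i = int (i + 1)"
        "array s'' = tab N (\<lambda>j. if j < i + 1 then cell_bound else g j)" for s''
    proof (intro exI[of _ "N - i"] conjI)
      show "J (N - i) s''" unfolding J_def
        using that i iN by (intro conjI exI[of _ "i + 1"]) simp_all
    qed (use i iN in \<open>simp_all add: of_nat_diff\<close>)
    show "yields (Compl[V R_i] ::= V R_L;; R_i ::= V R_i [+] C 1)
        (\<lambda>t s'. \<exists>k'<k. J k' s' \<and> real t + 1 + (3 * real k' + 1) \<le> 3 * real k + 1) s'"
      by (intro yields_Seq yields_Assign decr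
          yields_Write[where i = i and v = cell_bound and g = "\<lambda>j. if j < i then cell_bound else g j"])
        (use s' i(1,4,5) iN K upd in simp_all)
  next
    show "fits s'" if "J k s'" for k s' using that by (simp add: J_def)
  next
    show "1 \<le> 3 * real k + 1" for k by simp
  qed
  have startI: "I ?l s'" if "fits s'" "val s' R_N = int N" "array s' = tab N g" "val s' R_p = int N * int N * int N" "val s' R_L = 0" for s'
    unfolding I_def using that N_pos by (intro conjI exI[of _ "N ^ 3"] exI[of _ 0]) (simp_all add: power3_eq_cube)
  have startJ: "J N s'" if "fits s'" "val s' R_N = int N" "val s' R_L = int cell_bound" "val s' R_i = 1" "array s' = tab N g" for s'
  proof -
    have "tab N g = tab N (\<lambda>j. if j < 1 then cell_bound else g j)" by (auto simp: tab_def fun_eq_iff)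
    then show ?thesis unfolding J_def using that by (intro conjI exI[of _ 1]) simp_all
  qed
  have last: "yields (Compl[C 1] ::= C 1)
    (\<lambda>v s'. 1 + (1 + (1 + (t + (1 + (1 + (u + v)))))) \<le> 3 * cell_bound + 3 * N + 8 \<and> fits s' \<and> val s' R_N = int N \<and>
      array s' = tab N (\<lambda>i. if i = 1 then 1 else cell_bound)) s'"
    if t: "real t \<le> 3 * real ?l + 1" and
      H: "real u \<le> 3 * real N + 1 \<and> \<not> testval s' (V R_i [\<le>] V R_N) \<and> (\<exists>k. J k s')" for t u s'
  proof -
    obtain i where s': "fits s'" "val s' R_N = int N"
      and i: "i \<le> N + 1" "val s' R_i = int i" "array s' = tab N (\<lambda>j. if j < i then cell_bound else g j)"
      using H unfolding J_def by blast
    have i': "i = N + 1" using H i(1,2) s'(2) by simp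
    have arr: "array s' = tab N (\<lambda>_. cell_bound)" unfolding i(3) i' by (auto simp: tab_def fun_eq_iff)
    have upd: "(\<lambda>_. cell_bound)(Suc 0 := Suc 0) = (\<lambda>i. if i = Suc 0 then 1 else cell_bound)"
      by (simp add: fun_eq_iff)
    have "t \<le> 3 * ?l + 1" "u \<le> 3 * N + 1" using t H by linarith+
    then have time: "1 + (1 + (1 + (t + (1 + (1 + (u + 1)))))) \<le> 3 * cell_bound + 3 * N + 8"
      by (simp add: cell_bound_def)
    show ?thesis
      by (intro yields_Write[where i = 1 and v = 1 and g = "\<lambda>_. cell_bound"])
        (use s' arr upd time N_pos K in simp_all)
  qed
  have middle: "yields (R_L ::= V R_L [+] C 1;; R_i ::= Copy (C 1);;
     WHILE V R_i [\<le>] V R_N DO (Compl[V R_i] ::= V R_L;; R_i ::= V R_i [+] C 1);; Compl[C 1] ::= C 1)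
    (\<lambda>v s'. 1 + (1 + (1 + (t + v))) \<le> 3 * cell_bound + 3 * N + 8 \<and> fits s' \<and> val s' R_N = int N \<and>
      array s' = tab N (\<lambda>i. if i = 1 then 1 else cell_bound)) s'"
    if H: "real t \<le> 3 * real ?l + 1 \<and> \<not> testval s' (C 1 [<] V R_p) \<and> (\<exists>k. I k s')" for t s'
  proof -
    obtain p l where s': "fits s'" "val s' R_N = int N" "array s' = tab N g"
      and p: "1 \<le> p" "val s' R_p = int p" "l + floor_log p = ?l" "val s' R_L = int l"
      using H unfolding I_def by blast
    have "p = 1" using H p(1,2) by simp
    then have l: "int l + 1 = int cell_bound" using p(3) by (simp add: cell_bound_def)
    show ?thesis
      by (intro yields_Seq yields_Assign yields_mono[OF fill[OF startJ]] last)
        (use s' p(4) l K H in simp_all)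
  qed
  show ?thesis unfolding initialize_def
    by (intro middle yields_Seq yields_Assign yields_mono[OF halve[OF startI]])
      (insert s K K', simp_all, auto simp: abs_mult)
qed

text \<open>The last clause says that all products with both factors below \<open>n\<close> have been taken into account.\<close>

definition invariant :: "nat \<Rightarrow> (nat \<Rightarrow> nat) \<Rightarrow> bool" where
  "invariant n g \<longleftrightarrow> (\<forall>i. 1 \<le> i \<and> i \<le> N \<longrightarrow> \<parallel>i\<parallel> \<le> g i) \<and> (\<forall>i. 1 \<le> i \<and> i < n \<longrightarrow> g i = \<parallel>i\<parallel>) \<and>
     (\<forall>a b. 2 \<le> a \<and> a \<le> b \<and> b < n \<and> a * b \<le> N \<longrightarrow> g (a * b) \<le> \<parallel>a\<parallel> + \<parallel>b\<parallel>)"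

section \<open>Cost and correctness of the main loop\<close>

definition cost :: "nat \<Rightarrow> real" where
  "cost n = 20 * (real cell_bound + 1) ^ 2 + 20 * growth (n - 1) + 10 * (real N / real n) + 20"

text \<open>Establishes the invariant for the initial array. The index 1 is separate, since
  \<open>two_power_complexity_le\<close> starts at 2.\<close>

lemma complexity_le_cell_bound: "1 \<le> i \<Longrightarrow> i \<le> N \<Longrightarrow> \<parallel>i\<parallel> \<le> cell_bound"
proof (cases "i = 1")
  case False
  assume i: "1 \<le> i" "i \<le> N"
  have "2 ^ \<parallel>i\<parallel> \<le> i ^ 3" using False i by (intro two_power_complexity_le) simp
  also have "\<dots> \<le> N ^ 3" using i by (intro power_mono) auto
  finally have "floor_log (2 ^ \<parallel>i\<parallel>) \<le> floor_log (N ^ 3)" by (intro floor_log_le_iff)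
  then show ?thesis by (simp add: cell_bound_def)
qed (simp add: cell_bound_def)

text \<open>Candidates for \<open>n\<close> come from \<open>n - 1\<close> in \<open>step1\<close>,
  from sums in \<open>step3\<close>, and from products through the last clause of the invariant.
  Hence the entry at \<open>n\<close> is exact before \<open>step4\<close>, which then extends that
  clause to products with larger factor \<open>n\<close>.\<close>

lemma yields_body:
  assumes s: "here n g s" and n: "2 \<le> n" "n \<le> N" and invariant: "invariant n g"
  shows "yields (step1;; step2;; step3;; step4;; R_n ::= V R_n [+] C 1)
    (\<lambda>t s'. real t + 1 \<le> cost n \<and> (\<exists>g'. here (n + 1) g' s' \<and> invariant (n + 1) g')) s"
proof (rule yields_Seq, rule yields_mono[OF yields_step1[OF s n]], elim conjE)
  define T where "T = \<parallel>n - 1\<parallel>"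
  define g1 where "g1 = g(n := min (g n) (g (n - 1) + 1))"
  have g: "\<And>i. 1 \<le> i \<Longrightarrow> i \<le> N \<Longrightarrow> \<parallel>i\<parallel> \<le> g i" "\<And>i. 1 \<le> i \<Longrightarrow> i < n \<Longrightarrow> g i = \<parallel>i\<parallel>"
    "\<And>a b. 2 \<le> a \<Longrightarrow> a \<le> b \<Longrightarrow> b < n \<Longrightarrow> a * b \<le> N \<Longrightarrow> g (a * b) \<le> \<parallel>a\<parallel> + \<parallel>b\<parallel>"
    using invariant by (auto simp: invariant_def)
  have gT: "g (n - 1) = T" using g(2)[of "n - 1"] n by (simp add: T_def)
  have g1: "g1 (n - 1) = T" "\<parallel>n\<parallel> \<le> g1 n" "g1 n \<le> T + 1" "g1 n \<le> g n" "\<And>i. i \<noteq> n \<Longrightarrow> g1 i = g i"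
    using gT n g(1)[of n] complexity_Suc_le[of "n - 1"] by (auto simp: g1_def T_def)
  have TL: "T \<le> cell_bound" using complexity_le_cell_bound[of "n - 1"] n by (simp add: T_def)
  fix t1 :: nat and s1 assume t1: "t1 \<le> 7" and "here n (g(n := min (g n) (g (n - 1) + 1))) s1"
  then have s1: "here n g1 s1" by (simp add: g1_def)
  show "yields (step2;; step3;; step4;; R_n ::= V R_n [+] C 1)
    (\<lambda>u s'. real (t1 + u) + 1 \<le> cost n \<and> (\<exists>g'. here (n + 1) g' s' \<and> invariant (n + 1) g')) s1"
  proof (rule yields_Seq, rule yields_mono[OF yields_step2[OF s1 n g1(1) T_def]], elim exE conjE)
    fix t2 s2 t
    assume t2: "t2 \<le> 20 * (T + 1) ^ 2" and s2: "here n g1 s2" "val s2 R_kMax = int (E t)"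
      and t: "t \<le> T div 2" "n \<le> E t + E (T - t)" "\<forall>u. t < u \<longrightarrow> u \<le> T div 2 \<longrightarrow> E u + E (T - u) < n"
    have "E t \<le> E (T div 2)" using t(1) by (rule E_mono)
    also have "\<dots> \<le> n - 1" using E_half_complexity_le[of "n - 1"] n by (simp add: T_def)
    finally have kMax: "E t < n" using n by linarith
    have g1': "\<forall>i. 1 \<le> i \<and> i < n \<longrightarrow> g1 i = \<parallel>i\<parallel>" using g(2) by (simp add: g1_def)
    show "yields (step3;; step4;; R_n ::= V R_n [+] C 1)
      (\<lambda>u s'. real (t1 + (t2 + u)) + 1 \<le> cost n \<and> (\<exists>g'. here (n + 1) g' s' \<and> invariant (n + 1) g')) s2"
    proof (rule yields_Seq, rule yields_mono[OF yields_step3[OF s2(1) n s2(2) kMax g1' g1(2)]], elim exE conjE)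
      fix t3 s3 v
      assume t3: "t3 \<le> 10 * E t + 2" and s3: "here n (g1(n := v)) s3" and v: "\<parallel>n\<parallel> \<le> v" "v \<le> g1 n"
        "\<forall>m. 6 \<le> m \<and> m \<le> E t \<longrightarrow> v \<le> \<parallel>m\<parallel> + \<parallel>n - m\<parallel>"
      have "v \<le> \<parallel>n\<parallel>"
      proof (cases rule: complexity_attained[OF n(1) T_def, of t])
        \<comment> \<open>The first of the four cases is the hypothesis on \<open>t\<close>, so this
          one is the product, whose candidate value is already accounted for by the invariant
          because \<open>b < n\<close>.\<close>
        case (4 a b)
        then show ?thesis using g(3)[of a b] v(2) g1(4) n by simp
      qed (use t(3) v g1(3) T_def in auto)
      then have vn: "v = \<parallel>n\<parallel>" using v(1) by simp
      define g3 where "g3 = g(n := \<parallel>n\<parallel>)"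
      have g3: "here n g3 s3" using s3 by (simp add: vn g1_def g3_def)
      have g3': "\<forall>i. 1 \<le> i \<and> i \<le> n \<longrightarrow> g3 i = \<parallel>i\<parallel>" "\<forall>i. 1 \<le> i \<and> i \<le> N \<longrightarrow> \<parallel>i\<parallel> \<le> g3 i" "\<And>i. 1 \<le> i \<Longrightarrow> i \<le> N \<Longrightarrow> g3 i \<le> g i"
        using g(1,2) n by (auto simp: g3_def)
      show "yields (step4;; R_n ::= V R_n [+] C 1)
        (\<lambda>u s'. real (t1 + (t2 + (t3 + u))) + 1 \<le> cost n \<and> (\<exists>g'. here (n + 1) g' s' \<and> invariant (n + 1) g')) s3"
      proof (rule yields_Seq, rule yields_mono[OF yields_step4[OF g3 n g3'(1,2)]], elim exE conjE)
        fix t4 s4 g4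
        assume t4: "t4 \<le> 10 * (N div n) + 5" and s4: "here n g4 s4"
          and g4: "\<forall>i. 1 \<le> i \<and> i \<le> N \<longrightarrow> \<parallel>i\<parallel> \<le> g4 i \<and> g4 i \<le> g3 i" "\<forall>i. i \<le> n \<longrightarrow> g4 i = g3 i"
            "\<forall>j. 2 \<le> j \<and> j \<le> n \<and> j * n \<le> N \<longrightarrow> g4 (j * n) \<le> \<parallel>j\<parallel> + \<parallel>n\<parallel>"
        have prods: "g4 (a * b) \<le> \<parallel>a\<parallel> + \<parallel>b\<parallel>" if "2 \<le> a" "a \<le> b" "b < n + 1" "a * b \<le> N" for a b
        proof (cases "b = n")
          case True
          then show ?thesis using g4(3) that by simp
        next
          case False
          have "1 \<le> a * b" using that by simp
          then have "g4 (a * b) \<le> g (a * b)" using g4(1) g3'(3)[of "a * b"] that(4) by (meson order_trans)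
          then show ?thesis using g(3)[of a b] that False by simp
        qed
        have invariant': "invariant (n + 1) g4" unfolding invariant_def using g4(1,2) g3'(1) prods by simp
        have "n + 1 \<le> reg_bound" using n reg_bound_ge(1) by (simp add: reg_bound_def)
        \<comment> \<open>The first three summands of \<open>cost\<close> pay for
          \<open>step2\<close>, \<open>step3\<close> and \<open>step4\<close>, the last one for the
          remaining constants. In the second, \<open>10 * E t\<close> has been replaced using
          \<open>E t \<le> 2 * growth (n - 1)\<close>.\<close>
        have "real (t1 + (t2 + (t3 + (t4 + 1)))) + 1 \<le> cost n"
        proof -
          have "t1 + (t2 + (t3 + (t4 + 1))) \<le> 20 * (T + 1) ^ 2 + 10 * E t + 10 * (N div n) + 15"
            using t1 t2 t3 t4 by simp
          then have "real (t1 + (t2 + (t3 + (t4 + 1)))) \<le> real (20 * (T + 1) ^ 2 + 10 * E t + 10 * (N div n) + 15)"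
            by (simp only: of_nat_le_iff)
          moreover have "real (20 * (T + 1) ^ 2) \<le> 20 * (real cell_bound + 1) ^ 2" using TL by (simp add: power_mono)
          moreover have "real (E t) \<le> 2 * growth (n - 1)" by (rule E_le_growth[OF n(1) T_def t(1,2)])
          moreover have "real (N div n) \<le> real N / real n" by (rule of_nat_div_le_of_nat)
          ultimately show ?thesis unfolding cost_def of_nat_add of_nat_mult of_nat_numeral by linarith
        qed
        with invariant' show "yields (R_n ::= V R_n [+] C 1)
          (\<lambda>u s'. real (t1 + (t2 + (t3 + (t4 + u)))) + 1 \<le> cost n \<and> (\<exists>g'. here (n + 1) g' s' \<and> invariant (n + 1) g')) s4"
          by (intro yields_Assign conjI exI[of _ g4])
            (use s4 \<open>n + 1 \<le> reg_bound\<close> in \<open>simp_all add: here_def\<close>)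
      qed
    qed
  qed
qed

lemma yields_time_improved:
  assumes s: "fits s" "val s R_N = int N" "array s = tab N g"
  shows "yields time_improved (\<lambda>t s'. real t \<le> 3 * real cell_bound + 3 * real N + 10 + (\<Sum>n = 2..N. cost n) \<and>
    (\<forall>n. 1 \<le> n \<and> n \<le> N \<longrightarrow> array s' (int n) = Some (int \<parallel>n\<parallel>))) s"
proof -
  define I where "I k s' \<longleftrightarrow> (\<exists>n g. k = N + 1 - n \<and> 2 \<le> n \<and> n \<le> N + 1 \<and> here n g s' \<and> invariant n g)" for k s'
  \<comment> \<open>With measure \<open>k\<close> the loop index is \<open>N + 1 - k\<close>, so the
    budget is the total cost of the passes still to come.\<close>
  have loop: "yields (WHILE V R_n [\<le>] V R_N DO (step1;; step2;; step3;; step4;; R_n ::= V R_n [+] C 1))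
    (\<lambda>t s'. real t \<le> (\<Sum>n = N + 1 - (N - 1)..N. cost n) + 1 \<and> \<not> testval s' (V R_n [\<le>] V R_N) \<and> (\<exists>k. I k s')) s1"
    if "I (N - 1) s1" for s1
    using that
  proof (rule yields_While[where P = "\<lambda>k. (\<Sum>n = N + 1 - k..N. cost n) + 1"])
    fix k s' assume I: "I k s'" and test: "testval s' (V R_n [\<le>] V R_N)"
    then obtain n g where n: "k = N + 1 - n" "2 \<le> n" "here n g s'" "invariant n g" unfolding I_def by blast
    have nN: "n \<le> N" using test n(3) by (simp add: here_def)
    have "{N + 1 - k..N} = insert n {n + 1..N}" using n(1) nN by auto
    then have sum: "(\<Sum>n = N + 1 - k..N. cost n) = cost n + (\<Sum>n = n + 1..N. cost n)" by simp
    show "yields (step1;; step2;; step3;; step4;; R_n ::= V R_n [+] C 1)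
      (\<lambda>t s'. \<exists>k'<k. I k' s' \<and> real t + 1 + ((\<Sum>n = N + 1 - k'..N. cost n) + 1) \<le> (\<Sum>n = N + 1 - k..N. cost n) + 1) s'"
    proof (rule yields_mono[OF yields_body[OF n(3,2) nN n(4)]], elim conjE exE)
      fix t s'' g' assume t: "real t + 1 \<le> cost n" and *: "here (n + 1) g' s''" "invariant (n + 1) g'"
      have "I (k - 1) s''" unfolding I_def using * n nN by (intro exI[of _ "n + 1"] exI[of _ g']) simp
      moreover have "N + 1 - (k - 1) = n + 1" "k - 1 < k" using n(1) nN by simp_all
      ultimately show "\<exists>k'<k. I k' s'' \<and> real t + 1 + ((\<Sum>n = N + 1 - k'..N. cost n) + 1) \<le> (\<Sum>n = N + 1 - k..N. cost n) + 1"
        unfolding sum using t by (intro exI[of _ "k - 1"]) simp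
    qed
  next
    show "fits s'" if "I k s'" for k s' using that by (auto simp: I_def here_def)
  next
    show "1 \<le> (\<Sum>n = N + 1 - k..N. cost n) + 1" for k
      by (simp add: cost_def sum_nonneg growth_nonneg)
  qed
  let ?g = "\<lambda>i. if i = 1 then 1 else cell_bound"
  \<comment> \<open>At \<open>n = 2\<close> the product clause is vacuous, and the entry 1 at index
    1 is exact.\<close>
  have invariant0: "invariant 2 ?g"
    using complexity_le_cell_bound by (auto simp: invariant_def less_2_cases_iff)
  have K: "2 \<le> reg_bound" using reg_bound_ge(3) by (simp add: reg_bound_def)
  show ?thesis unfolding time_improved_def
  proof (rule yields_Seq, rule yields_mono[OF yields_initialize[OF s]], elim conjE)
    fix t1 s1 assume t1: "t1 \<le> 3 * cell_bound + 3 * N + 8" and s1: "fits s1" "val s1 R_N = int N" "array s1 = tab N ?g"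
    have start: "I (N - 1) s2" if "fits s2" "val s2 = (val s1)(R_n := 2)" "array s2 = array s1" for s2
      unfolding I_def using that s1 invariant0 N_pos by (intro exI[of _ 2] exI[of _ ?g]) (simp add: here_def)
    have final: "real (t1 + (1 + u)) \<le> 3 * real cell_bound + 3 * real N + 10 + (\<Sum>n = 2..N. cost n) \<and>
        (\<forall>n. 1 \<le> n \<and> n \<le> N \<longrightarrow> array s' (int n) = Some (int \<parallel>n\<parallel>))"
      if H: "real u \<le> (\<Sum>n = N + 1 - (N - 1)..N. cost n) + 1 \<and> \<not> testval s' (V R_n [\<le>] V R_N) \<and> (\<exists>k. I k s')" for u s'
    proof (intro conjI allI impI)
      have "N + 1 - (N - 1) = 2" using N_pos by simp
      then have "real u \<le> (\<Sum>n = 2..N. cost n) + 1" using H by simp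
      moreover have "real t1 \<le> real (3 * cell_bound + 3 * N + 8)" using t1 by (simp only: of_nat_le_iff)
      ultimately show "real (t1 + (1 + u)) \<le> 3 * real cell_bound + 3 * real N + 10 + (\<Sum>n = 2..N. cost n)" by simp
      obtain n g where n: "n \<le> N + 1" "here n g s'" "invariant n g" using H unfolding I_def by blast
      have "n = N + 1" using H n(1,2) by (simp add: here_def)
      fix i assume "1 \<le> i \<and> i \<le> N"
      then show "array s' (int i) = Some (int \<parallel>i\<parallel>)"
        using n(2,3) \<open>n = N + 1\<close> by (simp add: here_def invariant_def)
    qed
    show "yields (R_n ::= Copy (C 2);;
       WHILE V R_n [\<le>] V R_N DO (step1;; step2;; step3;; step4;; R_n ::= V R_n [+] C 1))
       (\<lambda>u s'. real (t1 + u) \<le> 3 * real cell_bound + 3 * real N + 10 + (\<Sum>n = 2..N. cost n) \<and>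
        (\<forall>n. 1 \<le> n \<and> n \<le> N \<longrightarrow> array s' (int n) = Some (int \<parallel>n\<parallel>))) s1"
      by (intro yields_Seq yields_Assign yields_mono[OF loop[OF start]] final) (use s1 K in simp_all)
  qed
qed

lemma exec_time_improved:
  "\<exists>t b s. exec time_improved (input_state N) t b s \<and> b \<le> space_bound \<and>
     real t \<le> 3 * real cell_bound + 3 * real N + 10 + (\<Sum>n = 2..N. cost n) \<and>
     (\<forall>n. 1 \<le> n \<and> n \<le> N \<longrightarrow> array s (int n) = Some (int \<parallel>n\<parallel>))"
proof -
  have arr: "array (input_state N) = tab N (\<lambda>_. 0)" by (auto simp: input_state_def tab_def fun_eq_iff)
  have "\<bar>val (input_state N) r\<bar> \<le> int reg_bound" for r
  proof -
    have "N \<le> reg_bound" using reg_bound_ge(1) by (simp add: reg_bound_def)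
    then show ?thesis by (simp add: input_state_def)
  qed
  then have "fits (input_state N)" unfolding fits_def using arr by auto
  moreover have "val (input_state N) R_N = int N" by (simp add: input_state_def)
  ultimately show ?thesis using yields_time_improved[OF _ _ arr] unfolding yields_def by blast
qed

section \<open>Asymptotic bounds for time and space\<close>

lemma cell_bound_le_log: "real cell_bound \<le> 3 * log 2 (real N) + 1"
proof -
  have "real (floor_log (N ^ 3)) \<le> log 2 (real (N ^ 3))"
    using N_pos by (simp add: floor_log_altdef)
  then show ?thesis using N_pos by (simp add: cell_bound_def log_nat_power)
qed

lemma bits_le_log:
  assumes "1 \<le> m"
  shows "real (bits (int m)) \<le> log 2 (real m) + 2"
proof -
  have "0 \<le> log 2 (real m)" using assms by simp
  then show ?thesis using assms by (simp add: bits_def bitlen_alt_def)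
qed

text \<open>Entries of logarithmic size have doubly logarithmic width, which is multiplied by
  \<open>N\<close>; the fixed number of registers adds only \<open>O(log N)\<close>.\<close>

lemma space_bound_le:
  "real space_bound \<le> 18 * (log 2 (4 * real N ^ 3) + 2) + real N * (log 2 (3 * log 2 (real N) + 1) + 2)"
proof -
  have "real (bits (int reg_bound)) \<le> log 2 (4 * real N ^ 3) + 2"
    using bits_le_log[of reg_bound] N_pos by (simp add: reg_bound_def)
  moreover have "real (bits (int cell_bound)) \<le> log 2 (3 * log 2 (real N) + 1) + 2"
  proof -
    have "real (bits (int cell_bound)) \<le> log 2 (real cell_bound) + 2"
      by (rule bits_le_log) (simp add: cell_bound_def)
    moreover have "log 2 (real cell_bound) \<le> log 2 (3 * log 2 (real N) + 1)"
      using cell_bound_le_log by (intro log_mono) (auto simp: cell_bound_def)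
    ultimately show ?thesis by simp
  qed
  ultimately have "18 * real (bits (int reg_bound)) + real N * real (bits (int cell_bound)) \<le>
    18 * (log 2 (4 * real N ^ 3) + 2) + real N * (log 2 (3 * log 2 (real N) + 1) + 2)"
    by (intro add_mono mult_left_mono) auto
  then show ?thesis by (simp add: space_bound_def)
qed

text \<open>Taking \<open>x = m / (m + 1)\<close> in \<open>ln x \<le> x - 1\<close> gives
  \<open>1 / (m + 1) \<le> ln (m + 1) - ln m\<close>, and these differences telescope.\<close>

lemma sum_inverse_le_ln: "(\<Sum>n = 2..m. 1 / real n) \<le> ln (real m)" if "1 \<le> m"
  using that
proof (induction m rule: nat_induct_at_least)
  case (Suc m)
  have "ln (real m / real (Suc m)) \<le> real m / real (Suc m) - 1"
    using Suc.hyps by (intro ln_le_minus_one) simp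
  also have "\<dots> = - (1 / real (Suc m))" by (simp add: field_simps)
  finally have "1 / real (Suc m) \<le> ln (real (Suc m)) - ln (real m)"
    using Suc.hyps by (simp add: ln_div)
  moreover have "(\<Sum>n = 2..Suc m. 1 / real n) = (\<Sum>n = 2..m. 1 / real n) + 1 / real (Suc m)"
    using Suc.hyps by (simp add: sum.nat_ivl_Suc')
  ultimately show ?case using Suc.IH by simp
qed simp

text \<open>The growth terms reduce to the assumed bound after an index shift, the terms of
  \<open>step4\<close> form a harmonic sum, and the rest is the same for every
  \<open>n\<close>.\<close>

lemma sum_cost_le:
  assumes "\<And>m. (\<Sum>n = 1..m. growth n) \<le> c * real m powr (123/100)" "c \<ge> 0"
  shows "(\<Sum>n = 2..N. cost n) \<le> real N * (20 * (3 * log 2 (real N) + 2) ^ 2 + 20) +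
    20 * (c * real N powr (123/100)) + 10 * real N * ln (real N)"
proof -
  have "(\<Sum>n = 2..N. growth (n - 1)) = (\<Sum>n = 1..N - 1. growth n)"
    using N_pos by (intro sum.reindex_bij_witness[of _ Suc "\<lambda>n. n - 1"]) auto
  also have "\<dots> \<le> c * real (N - 1) powr (123/100)" by (rule assms(1))
  also have "\<dots> \<le> c * real N powr (123/100)" using assms(2) by (intro mult_left_mono powr_mono2) auto
  finally have 1: "(\<Sum>n = 2..N. growth (n - 1)) \<le> c * real N powr (123/100)" .
  have "(\<Sum>n = 2..N. real N / real n) = real N * (\<Sum>n = 2..N. 1 / real n)"
    by (simp add: sum_distrib_left)
  also have "\<dots> \<le> real N * ln (real N)" using sum_inverse_le_ln N_pos by (intro mult_left_mono) auto
  finally have 2: "(\<Sum>n = 2..N. real N / real n) \<le> real N * ln (real N)" .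
  have "(real cell_bound + 1) ^ 2 \<le> (3 * log 2 (real N) + 2) ^ 2"
    using cell_bound_le_log by (intro power_mono) simp_all
  then have "real (N - 1) * (20 * (real cell_bound + 1) ^ 2 + 20) \<le>
      real N * (20 * (3 * log 2 (real N) + 2) ^ 2 + 20)"
    by (intro mult_mono) auto
  moreover have "(\<Sum>n = 2..N. cost n) = real (N - 1) * (20 * (real cell_bound + 1) ^ 2 + 20) +
      20 * (\<Sum>n = 2..N. growth (n - 1)) + 10 * (\<Sum>n = 2..N. real N / real n)"
    by (simp add: cost_def sum.distrib sum_distrib_left algebra_simps)
  ultimately show ?thesis using 1 2 by linarith
qed

end

text \<open>All terms but the one with \<open>powr\<close> are at most of order \<open>N\<close>
  times the square of its logarithm, and 1.23 lies just below 1.230175.\<close>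

lemma time_bigo:
  fixes c :: real
  assumes "c > 0"
  shows "(\<lambda>N. 3 * (3 * log 2 (real N) + 1) + 3 * real N + 10 +
    (real N * (20 * (3 * log 2 (real N) + 2) ^ 2 + 20) + 20 * (c * real N powr (123/100)) + 10 * real N * ln (real N)))
    \<in> O(\<lambda>N. real N powr 1.230175)"
  using assms by real_asymp

lemma space_bigo:
  "(\<lambda>N. 18 * (log 2 (4 * real N ^ 3) + 2) + real N * (log 2 (3 * log 2 (real N) + 1) + 2))
    \<in> O(\<lambda>N. real N * ln (ln (real N)))"
  by real_asymp

theorem theorem13:
  shows "\<exists>(time :: nat \<Rightarrow> nat) (space :: nat \<Rightarrow> nat).
    (\<forall>N\<ge>1. \<exists>s. exec time_improved (input_state N) (time N) (space N) s \<and>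
       (\<forall>n. 1 \<le> n \<and> n \<le> N \<longrightarrow> array s (int n) = Some (int \<parallel>n\<parallel>))) \<and>
    (\<lambda>N. real (time N)) \<in> O(\<lambda>N. real N powr 1.230175) \<and>
    (\<lambda>N. real (space N)) \<in> O(\<lambda>N. real N * ln (ln (real N)))"
proof -
  obtain c where c: "c > 0" "\<And>m. (\<Sum>n = 1..m. growth n) \<le> c * real m powr (123/100)"
    using sum_growth_le by blast
  let ?T = "\<lambda>N. 3 * (3 * log 2 (real N) + 1) + 3 * real N + 10 +
    (real N * (20 * (3 * log 2 (real N) + 2) ^ 2 + 20) + 20 * (c * real N powr (123/100)) + 10 * real N * ln (real N))"
  let ?S = "\<lambda>N. 18 * (log 2 (4 * real N ^ 3) + 2) + real N * (log 2 (3 * log 2 (real N) + 1) + 2)"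
  let ?run = "\<lambda>N t b s. exec time_improved (input_state N) t b s \<and> real b \<le> ?S N \<and> real t \<le> ?T N \<and>
     (\<forall>n. 1 \<le> n \<and> n \<le> N \<longrightarrow> array s (int n) = Some (int \<parallel>n\<parallel>))"
  have "\<exists>t b s. ?run N t b s" if "1 \<le> N" for N
  proof -
    interpret bounded_run N by unfold_locales (rule that)
    obtain t b s where run: "exec time_improved (input_state N) t b s" "b \<le> space_bound"
      "real t \<le> 3 * real cell_bound + 3 * real N + 10 + (\<Sum>n = 2..N. cost n)"
      "\<forall>n. 1 \<le> n \<and> n \<le> N \<longrightarrow> array s (int n) = Some (int \<parallel>n\<parallel>)"
      using exec_time_improved by blast
    have "real b \<le> ?S N" using run(2) space_bound_le by linarith
    moreover have "real t \<le> ?T N"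
      by (rule order_trans[OF run(3)], rule add_mono[OF _ sum_cost_le[OF c(2) less_imp_le[OF c(1)]]])
        (use cell_bound_le_log in simp)
    ultimately show ?thesis using run(1,4) by blast
  qed
  \<comment> \<open>Moving the condition under the quantifiers lets \<open>time\<close> and
    \<open>space\<close> be chosen as total functions.\<close>
  then have "\<forall>N. \<exists>t b. 1 \<le> N \<longrightarrow> (\<exists>s. ?run N t b s)" by blast
  then obtain time space where run: "\<And>N. 1 \<le> N \<Longrightarrow> \<exists>s. ?run N (time N) (space N) s"
    by metis
  have time: "(\<lambda>N. real (time N)) \<in> O(?T)"
  proof (rule landau_o.big_mono)
    show "\<forall>\<^sub>F N in sequentially. norm (real (time N)) \<le> norm (?T N)"
      using eventually_ge_at_top[of 1] by eventually_elim (use run in force)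
  qed
  have space: "(\<lambda>N. real (space N)) \<in> O(?S)"
  proof (rule landau_o.big_mono)
    show "\<forall>\<^sub>F N in sequentially. norm (real (space N)) \<le> norm (?S N)"
      using eventually_ge_at_top[of 1] by eventually_elim (use run in force)
  qed
  show ?thesis
  proof (rule exI[of _ time], rule exI[of _ space], intro conjI allI impI)
    show "\<exists>s. exec time_improved (input_state N) (time N) (space N) s \<and>
       (\<forall>n. 1 \<le> n \<and> n \<le> N \<longrightarrow> array s (int n) = Some (int \<parallel>n\<parallel>))" if "1 \<le> N" for N
      using run[OF that] by blast
    show "(\<lambda>N. real (time N)) \<in> O(\<lambda>N. real N powr 1.230175)"
      using time time_bigo[OF c(1)] by (rule landau_o.big_trans)
    show "(\<lambda>N. real (space N)) \<in> O(\<lambda>N. real N * ln (ln (real N)))"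
      using space space_bigo by (rule landau_o.big_trans)
  qed
qed

end
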